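(* Let $1\le\beta\le\alpha$ be integers, and let $g_{\alpha,\beta}(x)$ be the toric $g$-polynomial of (the face lattice of) the hook shape lattice path matroid polytope $P_{\alpha,\beta}$. Then $$g_{\alpha,\beta}(x)=\sum_{k=0}^{\beta-1}\binom{\alpha-1}{k}\binom{\beta-1}{k}x^k.$$
   Context: The polytope $P_{\alpha,\beta}$: lattice paths in $\mathbb{Z}\times\mathbb{Z}$ use north steps $\mathsf{N}=(0,1)$ and east steps $\mathsf{E}=(1,0)$. Let $\pi_1=\mathsf{N}\mathsf{E}^{\alpha-1}\mathsf{N}^{\beta-1}\mathsf{E}$ and $\pi_2=\mathsf{E}^{\alpha}\mathsf{N}^{\beta}$, which enclose a hook shape. For each lattice path $\sigma=\sigma_1\cdots\sigma_{\alpha+\beta}$ from $(0,0)$ to $(\alpha,\beta)$ staying weakly between $\pi_1$ and $\pi_2$, let $B_\sigma=\{i:\sigma_i=\mathsf{N}\}$. Then $P_{\alpha,\beta}\subset\mathbb{R}^{\alpha+\beta}$ is the convex hull of the vectors $\sum_{i\in B_\sigma}\mathbf{e}_i$ over all such $\sigma$. Equivalently, $P_{\alpha,\beta}$ is the convex hull of $\mathbf{v}_{0,1}=\sum_{l=1}^{\beta}\mathbf{e}_{\alpha+l}$ and of all $\mathbf{v}_{i,j}=\mathbf{v}_{0,1}+\mathbf{e}_i-\mathbf{e}_{\alpha+j}$ with $1\le i\le\alpha$, $1\le j\le\beta$. Toric polynomials: let $\mathcal{P}$ be the face lattice of a convex polytope (including the empty face $\emptyset$ and the polytope itself), graded with rank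 function $\rho$, $\rho(\emptyset)=0$; a polytope of dimension $n$ has face lattice of rank $n+1$. Let $\widetilde{\mathcal{P}}$ be the set of all intervals $[\emptyset,y]$, $y\in\mathcal{P}$, with $\rho([\emptyset,y])=\rho(y)$. The toric $f$-polynomial $f(\mathcal{P},x)$ and toric $g$-polynomial $g(\mathcal{P},x)$ are defined inductively: (i) $f(\mathbf{1},x)=g(\mathbf{1},x)=1$ for the one-element poset $\mathbf{1}$; (ii) if $\mathcal{P}$ has rank $n+1>0$, then $$f(\mathcal{P},x)=\sum_{\mathcal{Q}\in\widetilde{\mathcal{P}},\ \mathcal{Q}\ne\mathcal{P}}g(\mathcal{Q},x)(x-1)^{n-\rho(\mathcal{Q})},$$ which has degree $n$; (iii) writing $f(\mathcal{P},x)=h_0+h_1x+\cdots+h_nx^n$, $g(\mathcal{P},x)=h_0+(h_1-h_0)x+\cdots+(h_m-h_{m-1})x^m$ with $m=\lfloor n/2\rfloor$. The toric polynomials of a polytope are those of its face lattice. *)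

theory Defs
  imports "HOL-Analysis.Analysis" "HOL-Computational_Algebra.Polynomial"
begin

datatype lstep = North | East

definition lattice_paths :: "nat \<Rightarrow> nat \<Rightarrow> lstep list set" where
  "lattice_paths a b = {s. count_list s East = a \<and> count_list s North = b}"

text \<open>A lattice path meets each antidiagonal \<open>x + y = k\<close> exactly once, namely after \<open>k\<close> steps.
  Hence a path with the same end points runs weakly below another one iff, for every \<open>k\<close>,
  its first \<open>k\<close> steps contain at most as many north steps.\<close>

definition weakly_below :: "lstep list \<Rightarrow> lstep list \<Rightarrow> bool" where
  "weakly_below s t \<longleftrightarrow>
     (\<forall>k \<le> length s. count_list (take k s) North \<le> count_list (take k t) North)"

definition hook_upper :: "nat \<Rightarrow> nat \<Rightarrow> lstep list" where
  "hook_upper a b = [North] @ replicate (a - 1) East @ replicate (b - 1) North @ [East]"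

definition hook_lower :: "nat \<Rightarrow> nat \<Rightarrow> lstep list" where
  "hook_lower a b = replicate a East @ replicate b North"

definition hook_paths :: "nat \<Rightarrow> nat \<Rightarrow> lstep list set" where
  "hook_paths a b =
     {s \<in> lattice_paths a b. weakly_below (hook_lower a b) s \<and> weakly_below s (hook_upper a b)}"

definition north_positions :: "lstep list \<Rightarrow> nat set" where
  "north_positions s = {i. 1 \<le> i \<and> i \<le> length s \<and> s ! (i - 1) = North}"

text \<open>The coordinates of \<open>real ^ 'n\<close> are numbered \<open>1, \<dots>, a + b\<close> by \<open>idx\<close>, so that the
  \<open>i\<close>-th standard unit vector is \<open>axis (idx i) 1\<close>.\<close>

definition hook_polytope :: "(nat \<Rightarrow> 'n::finite) \<Rightarrow> nat \<Rightarrow> nat \<Rightarrow> (real ^ 'n) set" where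
  "hook_polytope idx a b =
     convex hull ((\<lambda>s. \<Sum>i\<in>north_positions s. axis (idx i) 1) ` hook_paths a b)"

text \<open>A poset is given by its set of elements, ordered by the order of the ambient type.
  Its rank is the maximal length of a chain, where a chain with \<open>m + 1\<close> elements has length
  \<open>m\<close>. For a graded poset with least element, the rank of an element \<open>y\<close> is the rank of the
  interval of all elements below \<open>y\<close>.\<close>

definition poset_rank :: "'a::order set \<Rightarrow> nat" where
  "poset_rank P = Max {card C - 1 | C. C \<subseteq> P \<and> Complete_Partial_Order.chain (\<le>) C}"

definition lower_intervals :: "'a::order set \<Rightarrow> 'a set set" where
  "lower_intervals P = (\<lambda>y. {x \<in> P. x \<le> y}) ` P"

text \<open>The recursion is meaningful for finite graded posets with least and greatest element;
  for such posets rank 0 means having exactly one element. The value \<open>0\<close> on infinite posets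
  only serves to make the functions total. \<open>[:-1, 1:]\<close> is the polynomial \<open>x - 1\<close>.\<close>

function (sequential)
  toric_f :: "'a::order set \<Rightarrow> int poly" and
  toric_g :: "'a::order set \<Rightarrow> int poly" where
  "toric_f P =
     (if infinite P then 0
      else if poset_rank P = 0 then 1
      else (\<Sum>Q \<in> lower_intervals P - {P}.
              toric_g Q * [:-1, 1:] ^ (poset_rank P - 1 - poset_rank Q)))"
| "toric_g P =
     (if infinite P then 0
      else if poset_rank P = 0 then 1
      else monom (coeff (toric_f P) 0) 0 +
           (\<Sum>i = 1..(poset_rank P - 1) div 2.
              monom (coeff (toric_f P) i - coeff (toric_f P) (i - 1)) i))"
  by pat_completeness auto
termination
proof (relation "Wellfounded.measure (\<lambda>z. case z of Inl P \<Rightarrow> 2 * card P | Inr P \<Rightarrow> 2 * card P + 1)")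
  fix P Q :: "'a set"
  assume "\<not> infinite P" and "Q \<in> lower_intervals P - {P}"
  then have "card Q < card P"
    by (intro psubset_card_mono) (auto simp: lower_intervals_def)
  then show "(Inr Q, Inl P) \<in> Wellfounded.measure (\<lambda>z. case z of Inl P \<Rightarrow> 2 * card P | Inr P \<Rightarrow> 2 * card P + 1)"
    by simp
qed auto

declare toric_f.simps [simp del] toric_g.simps [simp del]

text \<open>\<open>face_of\<close> counts the empty set and \<open>S\<close> itself as faces of a convex set \<open>S\<close>.\<close>

definition face_lattice :: "'a::real_vector set \<Rightarrow> 'a set set" where
  "face_lattice S = {F. F face_of S}"

end

theory Submission
  imports Defs
begin

text \<open>
  The functional \<open>x\<^sub>1 + \<dots> + x\<^sub>\<alpha>\<close> vanishes at \<open>v\<^bsub>0,1\<^esub>\<close> and equals 1 at every \<open>v\<^bsub>i,j\<^esub>\<close>, and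
  \<open>v\<^bsub>i,j\<^esub> + v\<^bsub>i',j'\<^esub> = v\<^bsub>i,j'\<^esub> + v\<^bsub>i',j\<^esub>\<close>. So the hook polytope is a pyramid with apex \<open>v\<^bsub>0,1\<^esub>\<close> over
  a product of simplices of dimensions \<open>\<alpha> - 1\<close> and \<open>\<beta> - 1\<close>. Taking pyramids preserves the toric
  \<open>g\<close>-polynomial, and the lower intervals of the product are again products of simplices.
  Hence, by induction, it suffices that the polynomials
  \<open>G\<^bsub>a,b\<^esub> = \<Sum>\<^sub>k C(a-1,k) C(b-1,k) x\<^sup>k\<close> satisfy
  \<open>(x-1)\<^bsup>a+b-1\<^esup> + \<Sum>\<^bsub>1\<le>i\<le>a, 1\<le>j\<le>b\<^esub> C(a,i) C(b,j) G\<^bsub>i,j\<^esub> (x-1)\<^bsup>a+b-i-j\<^esup> = x\<^bsup>a+b-1\<^esup> G\<^bsub>a,b\<^esub>(1/x)\<close>.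
  This follows from the Delannoy-type recursion for the sums
  \<open>\<Sum>\<^sub>k C(a,k) C(b,k) x\<^bsup>b-k\<^esup>\<close>.\<close>

section \<open>Finite posets: rank and isomorphism\<close>

abbreviation principal_ideal :: "'a::order set \<Rightarrow> 'a \<Rightarrow> 'a set" where
  "principal_ideal P y \<equiv> {x \<in> P. x \<le> y}"

lemma finite_chain_lengths:
  assumes "finite P"
  shows "finite {card C - 1 | C. C \<subseteq> P \<and> Complete_Partial_Order.chain (\<le>) C}"
proof (rule finite_subset)
  show "{card C - 1 | C. C \<subseteq> P \<and> Complete_Partial_Order.chain (\<le>) C} \<subseteq> {..card P}"
  proof (rule subsetI)
    fix n assume "n \<in> {card C - 1 | C. C \<subseteq> P \<and> Complete_Partial_Order.chain (\<le>) C}"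
    then obtain C where "n = card C - 1" "C \<subseteq> P"
      by blast
    then show "n \<in> {..card P}"
      using card_mono[OF assms, of C] by simp
  qed
qed simp

lemma poset_rank_ge:
  assumes "finite P" "C \<subseteq> P" "Complete_Partial_Order.chain (\<le>) C"
  shows "card C - 1 \<le> poset_rank P"
  unfolding poset_rank_def
  by (rule Max_ge[OF finite_chain_lengths[OF assms(1)]]) (use assms in blast)

lemma poset_rank_chainE:
  assumes "finite P"
  obtains C where "C \<subseteq> P" "Complete_Partial_Order.chain (\<le>) C" "poset_rank P = card C - 1"
proof -
  have "{card C - 1 | C. C \<subseteq> P \<and> Complete_Partial_Order.chain (\<le>) C} \<noteq> {}"
    using chain_empty by blast
  from Max_in[OF finite_chain_lengths[OF assms] this] show ?thesis
    unfolding poset_rank_def[symmetric] using that by blast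
qed

text \<open>A strictly increasing map into the naturals is injective on chains, so a chain has at
  most \<open>N + 1\<close> elements. The upper bounds for pyramids and for products of simplices
  come from this.\<close>

lemma poset_rank_leI:
  assumes "finite P"
    and mono: "\<And>x y. x \<in> P \<Longrightarrow> y \<in> P \<Longrightarrow> x < y \<Longrightarrow> \<rho> x < \<rho> y"
    and le: "\<And>x. x \<in> P \<Longrightarrow> \<rho> x \<le> N"
  shows "poset_rank P \<le> N"
proof -
  obtain C where C: "C \<subseteq> P" "Complete_Partial_Order.chain (\<le>) C" "poset_rank P = card C - 1"
    using poset_rank_chainE[OF \<open>finite P\<close>] .
  have "inj_on \<rho> C"
  proof (rule inj_onI)
    fix x y assume xy: "x \<in> C" "y \<in> C" "\<rho> x = \<rho> y"
    then have "x \<le> y \<or> y \<le> x"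
      using C(2) by (auto simp: chain_def)
    then show "x = y"
      using mono[of x y] mono[of y x] xy C(1) by (auto simp: order_le_less)
  qed
  moreover have "\<rho> ` C \<subseteq> {..N}"
    using C(1) le by auto
  ultimately have "card C \<le> card {..N}"
    by (meson card_inj_on_le finite_atMost)
  then show ?thesis
    using C(3) by simp
qed

text \<open>A longest chain of \<open>Q\<close> can be prolonged by \<open>t\<close>.\<close>

lemma poset_rank_less:
  assumes "finite P" "Q \<subseteq> P" "Q \<noteq> {}" "t \<in> P" "\<And>x. x \<in> Q \<Longrightarrow> x < t"
  shows "poset_rank Q < poset_rank P"
proof -
  have fQ: "finite Q"
    using assms finite_subset by blast
  obtain C where C: "C \<subseteq> Q" "Complete_Partial_Order.chain (\<le>) C" "poset_rank Q = card C - 1"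
    using poset_rank_chainE[OF fQ] .
  obtain q where q: "q \<in> Q"
    using assms by blast
  \<comment> \<open>The empty chain also has length 0, by truncated subtraction; replacing it by a
    singleton ensures that inserting \<open>t\<close> really adds 1.\<close>
  define C' where "C' = (if C = {} then {q} else C)"
  have C': "C' \<subseteq> Q" "Complete_Partial_Order.chain (\<le>) C'" "poset_rank Q = card C' - 1" "C' \<noteq> {}"
    using C q by (auto simp: C'_def chain_def)
  have fC': "finite C'" "t \<notin> C'"
    using C'(1) fQ finite_subset assms(5) by blast+
  have "Complete_Partial_Order.chain (\<le>) (insert t C')"
    using C'(1,2) assms(5) unfolding chain_def by (auto intro: less_imp_le)
  then have "card (insert t C') - 1 \<le> poset_rank P"
    using assms C'(1) by (intro poset_rank_ge) auto
  moreover have "card C' > 0"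
    using C'(4) fC' by (simp add: card_gt_0_iff)
  ultimately show ?thesis
    using fC' C'(3) by simp
qed

lemma poset_rank_mono:
  assumes "finite P" "Q \<subseteq> P"
  shows "poset_rank Q \<le> poset_rank P"
proof -
  have "finite Q"
    using assms finite_subset by blast
  then obtain C where C: "C \<subseteq> Q" "Complete_Partial_Order.chain (\<le>) C" "poset_rank Q = card C - 1"
    by (rule poset_rank_chainE)
  then have "C \<subseteq> P"
    using assms(2) by blast
  then show ?thesis
    using poset_rank_ge[OF assms(1) _ C(2)] C(3) by simp
qed

lemma poset_rank_principal_ideal_less:
  assumes "finite P" "x \<in> P" "y \<in> P" "x < y"
  shows "poset_rank (principal_ideal P x) < poset_rank (principal_ideal P y)"
proof -
  have "finite (principal_ideal P y)" "principal_ideal P x \<subseteq> principal_ideal P y"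
    "principal_ideal P x \<noteq> {}" "y \<in> principal_ideal P y"
    using assms by auto
  then show ?thesis
    by (rule poset_rank_less) (use assms(4) in \<open>auto intro: le_less_trans\<close>)
qed

lemma principal_ideal_top:
  assumes "\<forall>x\<in>P. x \<le> t"
  shows "principal_ideal P t = P"
  using assms by auto

lemma poset_rank_principal_ideal_less_top:
  assumes "finite P" "t \<in> P" "\<forall>x\<in>P. x \<le> t" "y \<in> P" "y \<noteq> t"
  shows "poset_rank (principal_ideal P y) < poset_rank P"
proof -
  have "y < t"
    using bspec[OF assms(3,4)] assms(5) by (rule order_le_neq_trans)
  then have "poset_rank (principal_ideal P y) < poset_rank (principal_ideal P t)"
    by (rule poset_rank_principal_ideal_less[OF assms(1,4,2)])
  then show ?thesis
    unfolding principal_ideal_top[OF assms(3)] .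
qed

lemma poset_rank_singleton [simp]: "poset_rank {x} = 0"
proof -
  have "poset_rank {x} \<le> 0"
    by (rule poset_rank_leI[where \<rho> = "\<lambda>_. 0"]) auto
  then show ?thesis by simp
qed

lemma poset_rank_iso:
  fixes P :: "'a::order set" and Q :: "'b::order set"
  assumes "bij_betw \<phi> P Q" and iso: "\<And>x y. x \<in> P \<Longrightarrow> y \<in> P \<Longrightarrow> \<phi> x \<le> \<phi> y \<longleftrightarrow> x \<le> y"
  shows "poset_rank P = poset_rank Q"
proof -
  have inj: "inj_on \<phi> P" and img: "\<phi> ` P = Q"
    using assms by (auto simp: bij_betw_def)
  have ch: "Complete_Partial_Order.chain (\<le>) (\<phi> ` C) \<longleftrightarrow> Complete_Partial_Order.chain (\<le>) C" if "C \<subseteq> P" for C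
    using that iso unfolding chain_def by (simp add: subset_iff)
  have card: "card (\<phi> ` C) = card C" if "C \<subseteq> P" for C
    using inj that by (meson card_image inj_on_subset)
  have "{card C - 1 | C. C \<subseteq> P \<and> Complete_Partial_Order.chain (\<le>) C}
      = {card C - 1 | C. C \<subseteq> Q \<and> Complete_Partial_Order.chain (\<le>) C}" (is "?L = ?R")
  proof
    show "?L \<subseteq> ?R"
    proof clarify
      fix C assume "C \<subseteq> P" "Complete_Partial_Order.chain (\<le>) C"
      then show "\<exists>C'. card C - 1 = card C' - 1 \<and> C' \<subseteq> Q \<and> Complete_Partial_Order.chain (\<le>) C'"
        using ch card img by (intro exI[of _ "\<phi> ` C"]) auto
    qed
    show "?R \<subseteq> ?L"
    proof clarify
      fix C' assume C': "C' \<subseteq> Q" "Complete_Partial_Order.chain (\<le>) C'"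
      then obtain C where "C \<subseteq> P" "C' = \<phi> ` C"
        using img by (metis subset_imageE)
      then show "\<exists>C. card C' - 1 = card C - 1 \<and> C \<subseteq> P \<and> Complete_Partial_Order.chain (\<le>) C"
        using ch card C' by (intro exI[of _ C]) auto
    qed
  qed
  then show ?thesis by (simp add: poset_rank_def)
qed

text \<open>The recursion only sees the order, so induction on the number of elements suffices. The
  element types may differ, which later allows faces to be replaced by combinatorial labels.\<close>

lemma toric_iso:
  fixes P :: "'a::order set" and Q :: "'b::order set"
  assumes "bij_betw \<phi> P Q" and "\<And>x y. x \<in> P \<Longrightarrow> y \<in> P \<Longrightarrow> \<phi> x \<le> \<phi> y \<longleftrightarrow> x \<le> y"
  shows "toric_f P = toric_f Q \<and> toric_g P = toric_g Q"
  using assms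
proof (induction "card P" arbitrary: P Q rule: less_induct)
  case less
  note bij = less.prems(1) and iso = less.prems(2)
  have inj: "inj_on \<phi> P" and img: "\<phi> ` P = Q"
    using bij by (auto simp: bij_betw_def)
  have fin: "finite P \<longleftrightarrow> finite Q"
    using bij bij_betw_finite by blast
  have rank: "poset_rank P = poset_rank Q"
    by (rule poset_rank_iso[OF bij iso])
  show ?case
  proof (cases "finite P \<and> poset_rank P \<noteq> 0")
    case False
    then show ?thesis
      using fin rank by (simp add: toric_f.simps toric_g.simps)
  next
    case True
    have img_ideal: "\<phi> ` principal_ideal P y = principal_ideal Q (\<phi> y)" if "y \<in> P" for y
      using that iso img by auto
    have sub: "R \<subseteq> P" if "R \<in> lower_intervals P" for R
      using that by (auto simp: lower_intervals_def)
    have li: "lower_intervals Q = image \<phi> ` lower_intervals P"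
    proof -
      have "lower_intervals Q = (\<lambda>x. principal_ideal Q (\<phi> x)) ` P"
        unfolding lower_intervals_def img[symmetric] image_image ..
      also have "\<dots> = (\<lambda>x. \<phi> ` principal_ideal P x) ` P"
        using img_ideal by (intro image_cong) auto
      finally show ?thesis
        by (simp add: lower_intervals_def image_image)
    qed
    have inj_im: "inj_on (image \<phi>) (Pow P)"
      using inj by (rule inj_on_image_Pow)
    have "bij_betw (image \<phi>) (lower_intervals P - {P}) (lower_intervals Q - {Q})"
    proof -
      \<comment> \<open>\<open>P\<close> is inserted because no greatest element is assumed, so
        \<open>P\<close> need not itself be a lower interval.\<close>
      have "inj_on (image \<phi>) (insert P (lower_intervals P))"
        using inj_im by (rule inj_on_subset) (use sub in auto)
      then have "image \<phi> ` (lower_intervals P - {P}) = image \<phi> ` lower_intervals P - image \<phi> ` {P}"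
        by (rule inj_on_image_set_diff) auto
      then have "image \<phi> ` (lower_intervals P - {P}) = lower_intervals Q - {Q}"
        by (simp add: li img)
      moreover have "inj_on (image \<phi>) (lower_intervals P - {P})"
        using inj_im by (rule inj_on_subset) (use sub in auto)
      ultimately show ?thesis by (simp add: bij_betw_def)
    qed
    then have "(\<Sum>R \<in> lower_intervals Q - {Q}. toric_g R * [:-1, 1:] ^ (poset_rank Q - 1 - poset_rank R))
      = (\<Sum>R \<in> lower_intervals P - {P}. toric_g (\<phi> ` R) * [:-1, 1:] ^ (poset_rank Q - 1 - poset_rank (\<phi> ` R)))"
      by (rule sum.reindex_bij_betw[symmetric])
    also have "\<dots> = (\<Sum>R \<in> lower_intervals P - {P}. toric_g R * [:-1, 1:] ^ (poset_rank P - 1 - poset_rank R))"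
    proof (rule sum.cong[OF refl])
      fix R assume R: "R \<in> lower_intervals P - {P}"
      then have "card R < card P"
        using True sub by (intro psubset_card_mono) auto
      moreover have b: "bij_betw \<phi> R (\<phi> ` R)"
        using inj R sub by (meson DiffD1 inj_on_imp_bij_betw inj_on_subset)
      moreover have i: "\<And>x y. x \<in> R \<Longrightarrow> y \<in> R \<Longrightarrow> \<phi> x \<le> \<phi> y \<longleftrightarrow> x \<le> y"
        using iso R sub by blast
      ultimately have "toric_g R = toric_g (\<phi> ` R)"
        using less.hyps by blast
      then show "toric_g (\<phi> ` R) * [:-1, 1:] ^ (poset_rank Q - 1 - poset_rank (\<phi> ` R))
        = toric_g R * [:-1, 1:] ^ (poset_rank P - 1 - poset_rank R)"
        using rank poset_rank_iso[OF b i] by simp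
    qed
    finally have "toric_f P = toric_f Q"
      using True fin rank by (simp add: toric_f.simps)
    then show ?thesis
      using fin rank by (simp add: toric_g.simps)
  qed
qed

text \<open>An element is determined by its principal ideal, so the sum over intervals can run over
  elements; the interval \<open>P\<close> itself is the ideal of \<open>t\<close>.\<close>

lemma toric_f_eq_sum:
  assumes "finite P" "t \<in> P" "\<forall>x\<in>P. x \<le> t" "poset_rank P > 0"
  shows "toric_f P = (\<Sum>y \<in> P - {t}. toric_g (principal_ideal P y) *
           [:-1, 1:] ^ (poset_rank P - 1 - poset_rank (principal_ideal P y)))"
proof -
  have inj: "inj_on (principal_ideal P) P"
  proof (rule inj_onI)
    fix x y assume xy: "x \<in> P" "y \<in> P" and eq: "principal_ideal P x = principal_ideal P y"
    have "x \<in> principal_ideal P x" "y \<in> principal_ideal P y"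
      using xy by simp_all
    then have "x \<in> principal_ideal P y" "y \<in> principal_ideal P x"
      by (simp_all only: eq)
    then show "x = y"
      by (auto intro: order_antisym)
  qed
  have "lower_intervals P - {P} = principal_ideal P ` P - principal_ideal P ` {t}"
    using assms(3) by (auto simp: lower_intervals_def principal_ideal_top)
  also have "\<dots> = principal_ideal P ` (P - {t})"
    using inj assms(2) by (subst inj_on_image_set_diff[of _ P]) auto
  finally have "lower_intervals P - {P} = principal_ideal P ` (P - {t})" .
  moreover have "inj_on (principal_ideal P) (P - {t})"
    using inj by (rule inj_on_subset) auto
  ultimately show ?thesis
    using assms by (simp add: toric_f.simps sum.reindex)
qed

lemma coeff_toric_g:
  assumes "finite P" "poset_rank P > 0"
  shows "coeff (toric_g P) i =
    (if i = 0 then coeff (toric_f P) 0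
     else if i \<le> (poset_rank P - 1) div 2 then coeff (toric_f P) i - coeff (toric_f P) (i - 1) else 0)"
  using assms by (auto simp: toric_g.simps coeff_sum if_distrib cong: if_cong)

section \<open>Toric polynomials of pyramids\<close>

lemma toric_singleton: "toric_f {t} = 1" "toric_g {t} = 1"
  by (simp_all add: toric_f.simps toric_g.simps)

text \<open>Every proper ideal has strictly smaller rank, so each exponent is exactly one more than
  in \<open>toric_f_eq_sum\<close> and a factor \<open>x - 1\<close> comes out.\<close>

lemma toric_f_mult_sum:
  assumes "finite P" "t \<in> P" "\<forall>x\<in>P. x \<le> t" "poset_rank P > 0"
  shows "(\<Sum>y\<in>P - {t}. toric_g (principal_ideal P y) *
      [:-1, 1:] ^ (poset_rank P - poset_rank (principal_ideal P y))) = [:-1, 1:] * toric_f P"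
  unfolding toric_f_eq_sum[OF assms] sum_distrib_left
proof (rule sum.cong[OF refl])
  fix y assume "y \<in> P - {t}"
  then have "poset_rank (principal_ideal P y) < poset_rank P"
    using poset_rank_principal_ideal_less_top[OF assms(1-3)] by simp
  then have "poset_rank P - poset_rank (principal_ideal P y)
      = Suc (poset_rank P - 1 - poset_rank (principal_ideal P y))"
    by simp
  then show "toric_g (principal_ideal P y) * [:-1, 1:] ^ (poset_rank P - poset_rank (principal_ideal P y))
    = [:-1, 1:] * (toric_g (principal_ideal P y) *
      [:-1, 1:] ^ (poset_rank P - 1 - poset_rank (principal_ideal P y)))"
    by (simp only: power_Suc mult.left_commute)
qed

lemma poset_rank_eq_0_iff:
  assumes "finite P" "t \<in> P" "\<forall>x\<in>P. x \<le> t"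
  shows "poset_rank P = 0 \<longleftrightarrow> P = {t}"
proof
  assume "poset_rank P = 0"
  then show "P = {t}"
    using poset_rank_principal_ideal_less_top[OF assms] assms(2) by auto
qed simp

text \<open>The face lattice of a pyramid over a polytope with face lattice \<open>P\<close> is \<open>P \<times> UNIV\<close> with the
  product order, the second component telling whether the face contains the apex.\<close>

lemma bij_betw_times_False: "bij_betw (\<lambda>x. (x, False)) P (P \<times> {False})"
  by (auto simp: bij_betw_def inj_on_def)

lemma poset_rank_times_False: "poset_rank (P \<times> {False}) = poset_rank P"
  by (rule poset_rank_iso[OF bij_betw_times_False, symmetric]) (auto simp: less_eq_prod_def)

lemma toric_g_times_False: "toric_g (P \<times> {False}) = toric_g P"
proof -
  have "toric_f P = toric_f (P \<times> {False}) \<and> toric_g P = toric_g (P \<times> {False})"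
    by (rule toric_iso[OF bij_betw_times_False]) (auto simp: less_eq_prod_def)
  then show ?thesis by simp
qed

text \<open>Upper bound: the rank of the base face, plus 1 if the apex is present, is strictly
  increasing. Lower bound: the whole copy \<open>P \<times> {False}\<close> lies strictly below
  \<open>(t, True)\<close>.\<close>

lemma poset_rank_pyramid:
  assumes "finite P" "t \<in> P" "\<forall>x\<in>P. x \<le> t"
  shows "poset_rank (P \<times> (UNIV :: bool set)) = Suc (poset_rank P)"
proof (rule antisym)
  show "poset_rank (P \<times> (UNIV :: bool set)) \<le> Suc (poset_rank P)"
  proof (rule poset_rank_leI[where \<rho> = "\<lambda>(y, e). poset_rank (principal_ideal P y) + of_bool e"])
    show "finite (P \<times> (UNIV :: bool set))"
      using assms by simp
    show "(case z of (y, e) \<Rightarrow> poset_rank (principal_ideal P y) + of_bool e) \<le> Suc (poset_rank P)"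
      for z :: "'a \<times> bool"
      using poset_rank_mono[OF assms(1), of "principal_ideal P (fst z)"] by (auto split: prod.split)
    show "(case z of (y, e) \<Rightarrow> poset_rank (principal_ideal P y) + of_bool e)
        < (case w of (y, e) \<Rightarrow> poset_rank (principal_ideal P y) + of_bool e)"
      if "z \<in> P \<times> UNIV" "w \<in> P \<times> UNIV" "z < w" for z w :: "'a \<times> bool"
    proof (cases "fst z = fst w")
      case True
      then have "\<not> snd z" "snd w"
        using that(3) by (auto simp: less_prod_def less_eq_prod_def)
      then show ?thesis
        using True by (simp add: split_beta)
    next
      case False
      then have "fst z < fst w" "snd z \<le> snd w"
        using that(3) by (auto simp: less_prod_def less_eq_prod_def)
      then show ?thesis
        using poset_rank_principal_ideal_less[OF assms(1), of "fst z" "fst w"] that(1,2)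
        by (auto simp: split_beta intro!: add_less_le_mono)
    qed
  qed
  have "poset_rank (P \<times> {False}) < poset_rank (P \<times> (UNIV :: bool set))"
    by (rule poset_rank_less[where t = "(t, True)"])
       (use assms in \<open>auto simp: less_prod_def less_eq_prod_def\<close>)
  then show "Suc (poset_rank P) \<le> poset_rank (P \<times> (UNIV :: bool set))"
    by (simp add: poset_rank_times_False)
qed

lemma principal_ideal_pyramid:
  "principal_ideal (P \<times> UNIV) (y, True) = principal_ideal P y \<times> UNIV"
  "principal_ideal (P \<times> UNIV) (y, False) = principal_ideal P y \<times> {False}"
  by (auto simp: less_eq_prod_def)

text \<open>Faces without the apex are faces of the base, and the base itself contributes
  \<open>toric_g P\<close> with exponent 0. Proper faces with the apex are pyramids, whose rank is
  one higher, which lowers the exponent by one.\<close>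

lemma toric_f_pyramid_sum:
  fixes P :: "'a::order set"
  assumes "finite P" "t \<in> P" "\<forall>x\<in>P. x \<le> t"
  shows "toric_f (P \<times> (UNIV :: bool set)) = toric_g P +
    (\<Sum>y\<in>P - {t}. toric_g (principal_ideal P y) *
      [:-1, 1:] ^ (poset_rank P - poset_rank (principal_ideal P y))) +
    (\<Sum>y\<in>P - {t}. toric_g (principal_ideal P y \<times> (UNIV :: bool set)) *
      [:-1, 1:] ^ (poset_rank P - 1 - poset_rank (principal_ideal P y)))"
proof -
  let ?Q = "P \<times> (UNIV :: bool set)"
  let ?s = "\<lambda>z. toric_g (principal_ideal ?Q z) *
           [:-1, 1:] ^ (poset_rank ?Q - 1 - poset_rank (principal_ideal ?Q z))"
  have rank: "poset_rank (principal_ideal P y \<times> (UNIV :: bool set)) = Suc (poset_rank (principal_ideal P y))"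
    if "y \<in> P" for y
    by (rule poset_rank_pyramid[of _ y]) (use that assms in auto)
  have "toric_f ?Q = (\<Sum>z\<in>?Q - {(t, True)}. ?s z)"
    by (rule toric_f_eq_sum) (use assms in \<open>auto simp: less_eq_prod_def poset_rank_pyramid[OF assms]\<close>)
  also have "?Q - {(t, True)} = P \<times> {False} \<union> (P - {t}) \<times> {True}"
    using assms(2) by auto
  also have "(\<Sum>z\<in>P \<times> {False} \<union> (P - {t}) \<times> {True}. ?s z)
      = (\<Sum>z\<in>P \<times> {False}. ?s z) + (\<Sum>z\<in>(P - {t}) \<times> {True}. ?s z)"
    using assms(1) by (intro sum.union_disjoint) auto
  also have "(\<Sum>z\<in>P \<times> {False}. ?s z) = (\<Sum>y\<in>P. ?s (y, False))"
    by (rule sum.reindex_bij_witness[of _ "\<lambda>y. (y, False)" fst]) auto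
  also have "\<dots> = (\<Sum>y\<in>P. toric_g (principal_ideal P y) *
      [:-1, 1:] ^ (poset_rank P - poset_rank (principal_ideal P y)))"
    unfolding principal_ideal_pyramid toric_g_times_False poset_rank_times_False
      poset_rank_pyramid[OF assms] by simp
  also have "\<dots> = toric_g P + (\<Sum>y\<in>P - {t}. toric_g (principal_ideal P y) *
      [:-1, 1:] ^ (poset_rank P - poset_rank (principal_ideal P y)))"
    using assms by (subst sum.remove[of _ t]) (simp_all add: principal_ideal_top)
  also have "(\<Sum>z\<in>(P - {t}) \<times> {True}. ?s z) = (\<Sum>y\<in>P - {t}. ?s (y, True))"
    by (rule sum.reindex_bij_witness[of _ "\<lambda>y. (y, True)" fst]) auto
  also have "\<dots> = (\<Sum>y\<in>P - {t}. toric_g (principal_ideal P y \<times> (UNIV :: bool set)) *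
      [:-1, 1:] ^ (poset_rank P - 1 - poset_rank (principal_ideal P y)))"
    by (rule sum.cong) (auto simp: principal_ideal_pyramid rank poset_rank_pyramid[OF assms])
  finally show ?thesis .
qed

text \<open>By induction the two sums differ by a factor \<open>x - 1\<close>, so the pyramid has
  \<open>f\<close>-polynomial \<open>g + (x - 1) f + f = g + x f\<close>. Differences of its
  consecutive coefficients give back those of \<open>g\<close>.\<close>

lemma toric_g_pyramid:
  fixes P :: "'a::order set"
  assumes "finite P" "t \<in> P" "\<forall>x\<in>P. x \<le> t"
  shows "toric_g (P \<times> (UNIV :: bool set)) = toric_g P"
  using assms
proof (induction "card P" arbitrary: P t rule: less_induct)
  case less
  note P = less.prems
  have rank: "poset_rank (P \<times> (UNIV :: bool set)) = Suc (poset_rank P)"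
    using poset_rank_pyramid[OF P] .
  have fin: "finite (P \<times> (UNIV :: bool set))"
    using P by simp
  show ?case
  proof (cases "poset_rank P = 0")
    case True
    then have "P = {t}"
      using poset_rank_eq_0_iff[OF P] by simp
    then have "toric_f (P \<times> (UNIV :: bool set)) = 1"
      using toric_f_pyramid_sum[OF P] by (simp add: toric_singleton)
    then show ?thesis
      using rank fin True
      by (subst toric_g.simps) (simp add: toric_singleton \<open>P = {t}\<close> one_pCons monom_0)
  next
    case False
    have "toric_f (P \<times> (UNIV :: bool set)) = toric_g P +
      (\<Sum>y\<in>P - {t}. toric_g (principal_ideal P y) *
        [:-1, 1:] ^ (poset_rank P - poset_rank (principal_ideal P y))) +
      (\<Sum>y\<in>P - {t}. toric_g (principal_ideal P y) *
        [:-1, 1:] ^ (poset_rank P - 1 - poset_rank (principal_ideal P y)))"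
    proof -
      have "toric_g (principal_ideal P y \<times> (UNIV :: bool set)) = toric_g (principal_ideal P y)"
        if "y \<in> P - {t}" for y
      proof (rule less.hyps[where t = y])
        have "t \<notin> principal_ideal P y"
          using that P(3) by (auto intro: order_antisym)
        then show "card (principal_ideal P y) < card P"
          using P by (intro psubset_card_mono) auto
      qed (use that P in auto)
      then show ?thesis
        unfolding toric_f_pyramid_sum[OF P] by simp
    qed
    also have "(\<Sum>y\<in>P - {t}. toric_g (principal_ideal P y) *
        [:-1, 1:] ^ (poset_rank P - poset_rank (principal_ideal P y)))
      = [:-1, 1:] * (\<Sum>y\<in>P - {t}. toric_g (principal_ideal P y) *
        [:-1, 1:] ^ (poset_rank P - 1 - poset_rank (principal_ideal P y)))"
      using toric_f_mult_sum[OF P] toric_f_eq_sum[OF P] False by simp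
    also have "(\<Sum>y\<in>P - {t}. toric_g (principal_ideal P y) *
        [:-1, 1:] ^ (poset_rank P - 1 - poset_rank (principal_ideal P y))) = toric_f P"
      using toric_f_eq_sum[OF P] False by simp
    finally have f: "toric_f (P \<times> (UNIV :: bool set)) = toric_g P + pCons 0 (toric_f P)"
      by simp
    let ?n = "poset_rank P"
    show ?thesis
    proof (rule poly_eqI)
      fix i
      have g: "coeff (toric_g P) k = (if k = 0 then coeff (toric_f P) 0
        else if k \<le> (?n - 1) div 2 then coeff (toric_f P) k - coeff (toric_f P) (k - 1) else 0)" for k
        using False P by (intro coeff_toric_g) auto
      have f': "coeff (toric_f (P \<times> (UNIV :: bool set))) k =
         coeff (toric_g P) k + (if k = 0 then 0 else coeff (toric_f P) (k - 1))" for k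
        unfolding f by (cases k) auto
      have "coeff (toric_g (P \<times> (UNIV :: bool set))) i =
        (if i = 0 then coeff (toric_f (P \<times> (UNIV :: bool set))) 0
         else if i \<le> ?n div 2 then coeff (toric_f (P \<times> (UNIV :: bool set))) i
            - coeff (toric_f (P \<times> (UNIV :: bool set))) (i - 1) else 0)"
        using rank fin by (subst coeff_toric_g) auto
      \<comment> \<open>The pyramid may admit one more degree than \<open>P\<close>, but coefficient
        \<open>i - 1\<close> of \<open>toric_g P\<close> is still given by \<open>toric_f P\<close>,
        so the terms cancel.\<close>
      moreover have "i - 1 \<le> (?n - 1) div 2" if "i \<le> ?n div 2"
        using that by linarith
      ultimately show "coeff (toric_g (P \<times> (UNIV :: bool set))) i = coeff (toric_g P) i"
        unfolding f' g by auto
    qed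
  qed
qed

text \<open>Stanley's form of the recursion: multiplying \<open>toric_f P\<close> by \<open>x - 1\<close> turns its coefficients
  into differences of consecutive coefficients, so in low degrees the sum below only sees \<open>K\<close>.\<close>

lemma toric_g_eqI:
  assumes "finite P" "t \<in> P" "\<forall>x\<in>P. x \<le> t" "poset_rank P > 0"
    and sum: "(\<Sum>y\<in>P - {t}. toric_g (principal_ideal P y) *
      [:-1, 1:] ^ (poset_rank P - poset_rank (principal_ideal P y))) + K = R"
    and K: "\<And>i. i > (poset_rank P - 1) div 2 \<Longrightarrow> coeff K i = 0"
    and R: "\<And>i. i \<le> (poset_rank P - 1) div 2 \<Longrightarrow> coeff R i = 0"
  shows "toric_g P = K"
proof -
  have eq: "[:-1, 1:] * toric_f P + K = R"
    using sum toric_f_mult_sum[OF assms(1-4)] by simp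
  have c: "coeff R k = coeff K k - coeff (toric_f P) k + (if k = 0 then 0 else coeff (toric_f P) (k - 1))" for k
    unfolding eq[symmetric] by (cases k) (auto simp: coeff_pCons)
  show ?thesis
  proof (rule poly_eqI)
    fix i
    show "coeff (toric_g P) i = coeff K i"
    proof (cases "i \<le> (poset_rank P - 1) div 2")
      case True
      then show ?thesis
        using c[of i] R[of i] assms(1,4) by (cases "i = 0") (simp_all add: coeff_toric_g)
    next
      case False
      then show ?thesis
        using K[of i] assms(1,4) by (simp add: coeff_toric_g)
    qed
  qed
qed

section \<open>A binomial identity\<close>

text \<open>This is \<open>x^b * G(1/x)\<close> for \<open>G = binom_prod_sum a b\<close>, written
  without division so that it makes sense in any commutative ring.\<close>

definition rev_binom_prod_sum :: "nat \<Rightarrow> nat \<Rightarrow> 'a::comm_ring_1 \<Rightarrow> 'a" where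
  "rev_binom_prod_sum a b x = (\<Sum>k\<le>b. of_nat (a choose k) * of_nat (b choose k) * x ^ (b - k))"

text \<open>By Pascal's rule, \<open>(C(a+1,k) - C(a,k)) (C(b+1,k) - C(b,k))\<close> is
  \<open>C(a,k-1) C(b,k-1)\<close>, and 0 at \<open>k = 0\<close>. Expanding the left side gives
  four sums; an index shift turns the right side into one.\<close>

lemma rev_binom_prod_sum_rec:
  fixes x :: "'a::comm_ring_1"
  shows "rev_binom_prod_sum (Suc a) (Suc b) x =
    rev_binom_prod_sum a (Suc b) x + x * rev_binom_prod_sum (Suc a) b x + (1 - x) * rev_binom_prod_sum a b x"
proof -
  let ?C = "\<lambda>n k. of_nat (n choose k) :: 'a"
  \<comment> \<open>The range extends to \<open>Suc b\<close> because \<open>C(b,b+1) = 0\<close>;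
    all four sums then share one range.\<close>
  have D: "x * rev_binom_prod_sum n b x = (\<Sum>k\<le>Suc b. ?C n k * ?C b k * x ^ (Suc b - k))" for n
    by (simp add: rev_binom_prod_sum_def sum_distrib_left Suc_diff_le binomial_eq_0 algebra_simps)
  have "(\<Sum>k\<le>Suc b. (?C (Suc a) k - ?C a k) * (?C (Suc b) k - ?C b k) * x ^ (Suc b - k)) = rev_binom_prod_sum a b x"
    by (subst sum.atMost_Suc_shift) (simp add: rev_binom_prod_sum_def del: sum.atMost_Suc)
  moreover have "(\<Sum>k\<le>Suc b. (?C (Suc a) k - ?C a k) * (?C (Suc b) k - ?C b k) * x ^ (Suc b - k))
     = rev_binom_prod_sum (Suc a) (Suc b) x - rev_binom_prod_sum a (Suc b) x
       - x * rev_binom_prod_sum (Suc a) b x + x * rev_binom_prod_sum a b x"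
    unfolding D unfolding rev_binom_prod_sum_def sum_subtractf[symmetric] sum.distrib[symmetric]
    by (rule sum.cong) (simp_all add: algebra_simps)
  ultimately show ?thesis
    by (simp add: algebra_simps)
qed

text \<open>For fixed \<open>k\<close>, this is the share of one simplex in the double sum over
  nonempty faces: \<open>a choose i\<close> vertex sets of size \<open>i\<close>, each with its
  factor of the coefficient of \<open>x^k\<close> in \<open>G\<close>. Vertex sets are nonempty,
  hence the start at 1.\<close>

definition binom_conv :: "nat \<Rightarrow> nat \<Rightarrow> 'a::comm_ring_1 \<Rightarrow> 'a" where
  "binom_conv k a x = (\<Sum>i = 1..a. of_nat (a choose i) * of_nat ((i - 1) choose k) * (x - 1) ^ (a - i))"

text \<open>\<open>C(a,i) C(i,k) = C(a,k) C(a-k,i-k)\<close> reduces the sum to the expansion of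
  \<open>(1 + (x - 1))^(a-k)\<close>.\<close>

lemma sum_choose_mult_choose:
  fixes x :: "'a::comm_ring_1"
  shows "(\<Sum>i\<le>a. of_nat (a choose i) * of_nat (i choose k) * (x - 1) ^ (a - i))
    = of_nat (a choose k) * x ^ (a - k)"
proof (cases "k \<le> a")
  case True
  have "(\<Sum>i\<le>a. of_nat (a choose i) * of_nat (i choose k) * (x - 1) ^ (a - i))
    = (\<Sum>i\<in>{k..a}. of_nat (a choose i) * of_nat (i choose k) * (x - 1) ^ (a - i))"
    by (rule sum.mono_neutral_right) (auto simp: binomial_eq_0)
  also have "\<dots> = (\<Sum>i\<in>{k..a}. of_nat (a choose k) * of_nat ((a - k) choose (i - k)) * (x - 1) ^ (a - i))"
    by (rule sum.cong) (simp_all add: choose_mult flip: of_nat_mult)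
  also have "\<dots> = (\<Sum>j\<le>a-k. of_nat (a choose k) * of_nat ((a - k) choose j) * (x - 1) ^ (a - k - j))"
    by (rule sum.reindex_bij_witness[of _ "\<lambda>j. j + k" "\<lambda>i. i - k"]) (use True in auto)
  also have "\<dots> = of_nat (a choose k) * (1 + (x - 1)) ^ (a - k)"
    by (subst binomial_ring) (simp add: sum_distrib_left mult.assoc)
  finally show ?thesis by simp
next
  case False
  then show ?thesis
    by (auto simp: binomial_eq_0 intro!: sum.neutral)
qed

text \<open>After a shift of \<open>i\<close>, Pascal's rule splits \<open>C(a+1,i+1)\<close>: one
  part is \<open>sum_choose_mult_choose\<close>, the other is \<open>binom_conv k a x\<close> with
  one more factor \<open>x - 1\<close>.\<close>

lemma binom_conv_Suc:
  fixes x :: "'a::comm_ring_1"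
  shows "binom_conv k (Suc a) x = (x - 1) * binom_conv k a x + of_nat (a choose k) * x ^ (a - k)"
proof -
  have "binom_conv k (Suc a) x =
     (\<Sum>i\<le>a. of_nat (Suc a choose Suc i) * of_nat (i choose k) * (x - 1) ^ (a - i))"
    unfolding binom_conv_def
    by (rule sum.reindex_bij_witness[of _ Suc "\<lambda>i. i - 1"]) auto
  also have "\<dots> = (\<Sum>i\<le>a. of_nat (a choose i) * of_nat (i choose k) * (x - 1) ^ (a - i))
     + (\<Sum>i\<le>a. of_nat (a choose Suc i) * of_nat (i choose k) * (x - 1) ^ (a - i))"
    unfolding sum.distrib[symmetric] by (rule sum.cong) (simp_all add: algebra_simps)
  also have "(\<Sum>i\<le>a. of_nat (a choose Suc i) * of_nat (i choose k) * (x - 1) ^ (a - i))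
     = (\<Sum>i<a. of_nat (a choose Suc i) * of_nat (i choose k) * (x - 1) ^ (a - i))"
    by (rule sum.mono_neutral_right) (auto simp: binomial_eq_0)
  also have "\<dots> = (x - 1) * binom_conv k a x"
    unfolding binom_conv_def sum_distrib_left
  proof (rule sum.reindex_bij_witness[of _ "\<lambda>i. i - 1" Suc])
    fix i assume "i \<in> {..<a}"
    then have "(x - 1) ^ (a - i) = (x - 1) * (x - 1) ^ (a - Suc i)"
      by (simp add: Suc_diff_Suc flip: power_Suc)
    then show "(x - 1) * (of_nat (a choose Suc i) * of_nat ((Suc i - 1) choose k) * (x - 1) ^ (a - Suc i))
      = of_nat (a choose Suc i) * of_nat (i choose k) * (x - 1) ^ (a - i)"
      by (simp add: ac_simps)
  qed auto
  finally show ?thesis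
    by (simp add: sum_choose_mult_choose)
qed

lemma binom_conv_eq_0: "a \<le> k \<Longrightarrow> binom_conv k a x = 0"
  unfolding binom_conv_def by (rule sum.neutral) (auto simp: binomial_eq_0)

text \<open>Induction on \<open>b\<close>: \<open>binom_conv_Suc\<close> adds
  \<open>rev_binom_prod_sum (Suc a) (Suc b) x\<close> to \<open>x - 1\<close> times the previous
  sum, whose new term \<open>k = Suc b\<close> vanishes. The recursion
  \<open>rev_binom_prod_sum_rec\<close> closes the step.\<close>

lemma sum_choose_binom_conv:
  fixes x :: "'a::comm_ring_1"
  shows "(\<Sum>k\<le>b. of_nat (Suc a choose k) * binom_conv k (Suc b) x)
    = x * rev_binom_prod_sum (Suc a) b x - (x - 1) * rev_binom_prod_sum a b x"
proof (induction b)
  case 0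
  then show ?case by (simp add: binom_conv_def rev_binom_prod_sum_def)
next
  case (Suc b)
  have "(\<Sum>k\<le>Suc b. of_nat (Suc a choose k) * binom_conv k (Suc (Suc b)) x)
    = (x - 1) * (\<Sum>k\<le>Suc b. of_nat (Suc a choose k) * binom_conv k (Suc b) x)
      + rev_binom_prod_sum (Suc a) (Suc b) x"
    unfolding binom_conv_Suc[of _ "Suc b"] rev_binom_prod_sum_def sum_distrib_left sum.distrib[symmetric]
    by (rule sum.cong) (simp_all add: algebra_simps)
  also have "(\<Sum>k\<le>Suc b. of_nat (Suc a choose k) * binom_conv k (Suc b) x) =
     x * rev_binom_prod_sum (Suc a) b x - (x - 1) * rev_binom_prod_sum a b x"
    using Suc.IH by (simp add: binom_conv_eq_0)
  finally show ?case
    unfolding rev_binom_prod_sum_rec[of a b x] by (simp add: algebra_simps)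
qed

text \<open>Induction on \<open>a\<close>: \<open>binom_conv_Suc\<close> in the first factor leaves
  \<open>x - 1\<close> times the induction hypothesis and a power of \<open>x\<close> times the sum
  of \<open>sum_choose_binom_conv\<close>.\<close>

lemma sum_binom_conv_mult:
  fixes x :: "'a::comm_ring_1"
  shows "(\<Sum>k\<le>b. x ^ k * binom_conv k (Suc a) x * binom_conv k (Suc b) x)
    = x ^ Suc a * rev_binom_prod_sum a b x - (x - 1) ^ (a + b + 1)"
proof (induction a)
  case 0
  have one: "binom_conv k (Suc 0) x = (if k = 0 then 1 else 0)" for k
    by (cases k) (simp_all add: binom_conv_def)
  have "binom_conv 0 (Suc b) x = x ^ Suc b - (x - 1) ^ Suc b"
  proof (induction b)
    case (Suc b)
    show ?case
      unfolding binom_conv_Suc[of 0 "Suc b"] Suc.IH by (simp add: algebra_simps)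
  qed (simp add: one)
  moreover have "rev_binom_prod_sum 0 b x = x ^ b"
    unfolding rev_binom_prod_sum_def
    by (subst sum.remove[of _ 0]) (auto simp: binomial_eq_0 intro!: sum.neutral)
  moreover have "(\<Sum>k\<le>b. x ^ k * binom_conv k (Suc 0) x * binom_conv k (Suc b) x) = binom_conv 0 (Suc b) x"
    by (subst sum.remove[of _ 0]) (auto simp: one intro!: sum.neutral)
  ultimately show ?case by simp
next
  case (Suc a)
  \<comment> \<open>For \<open>k > Suc a\<close> the exponent is truncated, but then the binomial
    coefficient is 0.\<close>
  have *: "x ^ k * (of_nat (Suc a choose k) * x ^ (Suc a - k)) = x ^ Suc a * of_nat (Suc a choose k)" for k
  proof (cases "k \<le> Suc a")
    case True
    then have "x ^ k * x ^ (Suc a - k) = x ^ Suc a"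
      by (simp flip: power_add)
    then show ?thesis
      by (metis mult.left_commute mult.commute)
  qed (simp add: binomial_eq_0)
  have "(\<Sum>k\<le>b. x ^ k * binom_conv k (Suc (Suc a)) x * binom_conv k (Suc b) x)
    = (x - 1) * (\<Sum>k\<le>b. x ^ k * binom_conv k (Suc a) x * binom_conv k (Suc b) x)
      + x ^ Suc a * (\<Sum>k\<le>b. of_nat (Suc a choose k) * binom_conv k (Suc b) x)"
    unfolding binom_conv_Suc[of _ "Suc a"] sum_distrib_left sum.distrib[symmetric]
  proof (rule sum.cong[OF refl])
    fix k
    have "x ^ k * ((x - 1) * binom_conv k (Suc a) x + of_nat (Suc a choose k) * x ^ (Suc a - k)) * binom_conv k (Suc b) x
      = (x - 1) * (x ^ k * binom_conv k (Suc a) x * binom_conv k (Suc b) x)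
        + x ^ k * (of_nat (Suc a choose k) * x ^ (Suc a - k)) * binom_conv k (Suc b) x"
      by (simp only: distrib_left distrib_right mult_ac)
    then show "x ^ k * ((x - 1) * binom_conv k (Suc a) x + of_nat (Suc a choose k) * x ^ (Suc a - k)) * binom_conv k (Suc b) x
      = (x - 1) * (x ^ k * binom_conv k (Suc a) x * binom_conv k (Suc b) x) +
        x ^ Suc a * (of_nat (Suc a choose k) * binom_conv k (Suc b) x)"
      unfolding * by (simp only: mult.assoc)
  qed
  then show ?case
    unfolding Suc.IH sum_choose_binom_conv by (simp add: algebra_simps)
qed

text \<open>This is \<open>G\<close> with both indices raised by one: the parameters are the
  dimensions of the simplices, not their numbers of vertices.\<close>

definition binom_prod_sum :: "nat \<Rightarrow> nat \<Rightarrow> 'a::comm_ring_1 \<Rightarrow> 'a" where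
  "binom_prod_sum a b x = (\<Sum>k\<le>b. of_nat (a choose k) * of_nat (b choose k) * x ^ k)"

lemma binom_prod_sum_extend:
  assumes "b \<le> c"
  shows "binom_prod_sum a b x = (\<Sum>k\<le>c. of_nat (a choose k) * of_nat (b choose k) * x ^ k)"
  unfolding binom_prod_sum_def using assms
  by (intro sum.mono_neutral_left) (auto simp: binomial_eq_0)

text \<open>With the sum over \<open>k\<close> pulled outside, the double sum factors into two
  values of \<open>binom_conv\<close>. The subtracted power of \<open>x - 1\<close> is the term of
  the empty face.\<close>

lemma sum_binom_prod_sum:
  fixes x :: "'a::comm_ring_1"
  shows "(\<Sum>i=1..Suc a. \<Sum>j=1..Suc b. of_nat (Suc a choose i) * of_nat (Suc b choose j) *
      binom_prod_sum (i - 1) (j - 1) x * (x - 1) ^ (Suc a - i + (Suc b - j)))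
    = x ^ Suc a * rev_binom_prod_sum a b x - (x - 1) ^ (a + b + 1)"
proof -
  have "(\<Sum>k\<le>b. x ^ k * binom_conv k (Suc a) x * binom_conv k (Suc b) x)
    = (\<Sum>k\<le>b. \<Sum>i=1..Suc a. \<Sum>j=1..Suc b.
         x ^ k * (of_nat (Suc a choose i) * of_nat ((i - 1) choose k) * (x - 1) ^ (Suc a - i)) *
         (of_nat (Suc b choose j) * of_nat ((j - 1) choose k) * (x - 1) ^ (Suc b - j)))"
    unfolding binom_conv_def
    by (simp only: sum_product sum_distrib_left[of "x ^ _"] mult.assoc)
  also have "\<dots> = (\<Sum>i=1..Suc a. \<Sum>k\<le>b. \<Sum>j=1..Suc b.
         x ^ k * (of_nat (Suc a choose i) * of_nat ((i - 1) choose k) * (x - 1) ^ (Suc a - i)) *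
         (of_nat (Suc b choose j) * of_nat ((j - 1) choose k) * (x - 1) ^ (Suc b - j)))"
    by (rule sum.swap)
  also have "\<dots> = (\<Sum>i=1..Suc a. \<Sum>j=1..Suc b. \<Sum>k\<le>b.
         x ^ k * (of_nat (Suc a choose i) * of_nat ((i - 1) choose k) * (x - 1) ^ (Suc a - i)) *
         (of_nat (Suc b choose j) * of_nat ((j - 1) choose k) * (x - 1) ^ (Suc b - j)))"
    by (intro sum.cong[OF refl] sum.swap)
  also have "\<dots> = (\<Sum>i=1..Suc a. \<Sum>j=1..Suc b. of_nat (Suc a choose i) * of_nat (Suc b choose j) *
      binom_prod_sum (i - 1) (j - 1) x * (x - 1) ^ (Suc a - i + (Suc b - j)))"
  proof (intro sum.cong[OF refl])
    fix i j assume "j \<in> {1..Suc b}"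
    then have *: "binom_prod_sum (i - 1) (j - 1) x =
       (\<Sum>k\<le>b. of_nat ((i - 1) choose k) * of_nat ((j - 1) choose k) * x ^ k)"
      by (intro binom_prod_sum_extend) auto
    show "(\<Sum>k\<le>b. x ^ k * (of_nat (Suc a choose i) * of_nat ((i - 1) choose k) * (x - 1) ^ (Suc a - i)) *
         (of_nat (Suc b choose j) * of_nat ((j - 1) choose k) * (x - 1) ^ (Suc b - j)))
       = of_nat (Suc a choose i) * of_nat (Suc b choose j) *
          binom_prod_sum (i - 1) (j - 1) x * (x - 1) ^ (Suc a - i + (Suc b - j))"
      unfolding * power_add sum_distrib_left sum_distrib_right
      by (rule sum.cong[OF refl]) (simp only: mult_ac)
  qed
  finally show ?thesis
    unfolding sum_binom_conv_mult by (rule sym)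
qed

section \<open>Products of two simplices\<close>

text \<open>A nonempty face of the product of the simplices on the vertex sets \<open>A\<close> and \<open>B\<close> is identified
  with its vertex set \<open>I \<times> J\<close>; all choices with \<open>I\<close> or \<open>J\<close> empty give the empty face.\<close>

definition box_poset :: "'a set \<Rightarrow> 'b set \<Rightarrow> ('a \<times> 'b) set set" where
  "box_poset A B = {I \<times> J | I J. I \<subseteq> A \<and> J \<subseteq> B}"

lemma box_posetI: "I \<subseteq> A \<Longrightarrow> J \<subseteq> B \<Longrightarrow> I \<times> J \<in> box_poset A B"
  by (auto simp: box_poset_def)

lemma box_posetE:
  assumes "X \<in> box_poset A B"
  obtains I J where "X = I \<times> J" "I \<subseteq> A" "J \<subseteq> B"
  using assms by (auto simp: box_poset_def)

lemma finite_box_poset: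
  assumes "finite A" "finite B"
  shows "finite (box_poset A B)"
proof (rule finite_subset)
  show "box_poset A B \<subseteq> Pow (A \<times> B)"
    by (auto elim!: box_posetE)
qed (use assms in simp)

lemma box_poset_top: "A \<times> B \<in> box_poset A B" "\<forall>X\<in>box_poset A B. X \<subseteq> A \<times> B"
  by (auto intro: box_posetI elim!: box_posetE)

lemma empty_in_box_poset: "{} \<in> box_poset A B"
  using box_posetI[of "{}" A "{}" B] by simp

lemma box_poset_mono:
  assumes "I \<subseteq> A" "J \<subseteq> B"
  shows "box_poset I J \<subseteq> box_poset A B"
proof
  fix X assume "X \<in> box_poset I J"
  then obtain I' J' where "X = I' \<times> J'" "I' \<subseteq> I" "J' \<subseteq> J"
    by (rule box_posetE)
  then show "X \<in> box_poset A B"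
    using assms by (simp add: box_posetI)
qed

lemma principal_ideal_box_poset:
  assumes "I \<subseteq> A" "J \<subseteq> B"
  shows "principal_ideal (box_poset A B) (I \<times> J) = box_poset I J"
proof
  show "principal_ideal (box_poset A B) (I \<times> J) \<subseteq> box_poset I J"
  proof
    fix X assume "X \<in> principal_ideal (box_poset A B) (I \<times> J)"
    then obtain I' J' where X: "X = I' \<times> J'" "I' \<times> J' \<subseteq> I \<times> J"
      by (auto elim: box_posetE)
    \<comment> \<open>Inclusion of boxes gives inclusion of their sides only if the smaller box is
      nonempty.\<close>
    show "X \<in> box_poset I J"
    proof (cases "X = {}")
      case False
      then have "I' \<subseteq> I" "J' \<subseteq> J"
        using X by (auto simp: times_subset_iff)
      then show ?thesis
        using X(1) by (simp add: box_posetI)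
    qed (simp add: empty_in_box_poset)
  qed
  show "box_poset I J \<subseteq> principal_ideal (box_poset A B) (I \<times> J)"
    using box_poset_mono[OF assms] box_poset_top(2)[of I J] by blast
qed

lemma poset_rank_box_poset_less:
  assumes "finite A" "finite B" "I \<subseteq> A" "J \<subseteq> B" "I \<times> J \<noteq> A \<times> B"
  shows "poset_rank (box_poset I J) < poset_rank (box_poset A B)"
proof (rule poset_rank_less)
  show "finite (box_poset A B)"
    using assms by (simp add: finite_box_poset)
  show "box_poset I J \<subseteq> box_poset A B"
    using assms by (simp add: box_poset_mono)
  show "box_poset I J \<noteq> {}"
    using empty_in_box_poset[of I J] by (metis empty_iff)
  show "A \<times> B \<in> box_poset A B"
    by (rule box_poset_top)
  have "I \<times> J \<subset> A \<times> B"
    using assms by (simp add: psubset_eq Sigma_mono)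
  then show "X < A \<times> B" if "X \<in> box_poset I J" for X
    using bspec[OF box_poset_top(2) that] by (metis subset_psubset_trans)
qed

text \<open>Adding vertices one at a time raises the rank each time, starting from a single vertex
  above the empty face.\<close>

lemma poset_rank_box_poset_ge:
  assumes "finite A" "A \<noteq> {}" "finite B" "B \<noteq> {}"
  shows "card A + card B \<le> Suc (poset_rank (box_poset A B))"
  using assms(1,2)
proof (induction A rule: finite_ne_induct)
  case (singleton x)
  show ?case
    using assms(3,4)
  proof (induction B rule: finite_ne_induct)
    case (singleton y)
    have "poset_rank (box_poset ({} :: 'a set) ({} :: 'b set)) < poset_rank (box_poset {x} {y})"
      by (rule poset_rank_box_poset_less) simp_all
    then show ?case by simp
  next
    case (insert y F)
    have "poset_rank (box_poset {x} F) < poset_rank (box_poset {x} (insert y F))"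
      by (rule poset_rank_box_poset_less) (use insert.hyps in \<open>auto simp: times_eq_iff\<close>)
    then show ?case
      using insert by simp
  qed
next
  case (insert x F)
  have "poset_rank (box_poset F B) < poset_rank (box_poset (insert x F) B)"
    by (rule poset_rank_box_poset_less) (use insert.hyps assms in \<open>auto simp: times_eq_iff\<close>)
  then show ?case
    using insert by simp
qed

lemma poset_rank_box_poset:
  assumes "finite A" "A \<noteq> {}" "finite B" "B \<noteq> {}"
  shows "poset_rank (box_poset A B) = card A + card B - 1"
proof (rule antisym)
  \<comment> \<open>On a nonempty face this is the dimension plus one. The projections recover the
    sides of nonempty boxes only, so the empty face gets its own value.\<close>
  define \<rho> :: "('a \<times> 'b) set \<Rightarrow> nat"
    where "\<rho> = (\<lambda>X. if X = {} then 0 else card (fst ` X) + card (snd ` X) - 1)"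
  have box: "\<rho> (I \<times> J) = card I + card J - 1" "0 < card I" "0 < card J"
    if "I \<times> J \<noteq> {}" "I \<subseteq> A" "J \<subseteq> B" for I J
    using that assms finite_subset by (auto simp: \<rho>_def card_gt_0_iff)
  show "poset_rank (box_poset A B) \<le> card A + card B - 1"
  proof (rule poset_rank_leI[where \<rho> = \<rho>])
    show "\<rho> X \<le> card A + card B - 1" if "X \<in> box_poset A B" for X
    proof -
      obtain I J where X: "X = I \<times> J" "I \<subseteq> A" "J \<subseteq> B"
        using \<open>X \<in> box_poset A B\<close> by (rule box_posetE)
      then have "card I \<le> card A" "card J \<le> card B"
        using assms by (auto intro: card_mono)
      then show ?thesis
        using box[of I J] X by (cases "X = {}") (auto simp: \<rho>_def)
    qed
    show "\<rho> X < \<rho> Y" if "X \<in> box_poset A B" "Y \<in> box_poset A B" "X < Y" for X Y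
    proof -
      obtain I J where X: "X = I \<times> J" "I \<subseteq> A" "J \<subseteq> B"
        using \<open>X \<in> box_poset A B\<close> by (rule box_posetE)
      obtain I' J' where Y: "Y = I' \<times> J'" "I' \<subseteq> A" "J' \<subseteq> B"
        using \<open>Y \<in> box_poset A B\<close> by (rule box_posetE)
      have "Y \<noteq> {}"
        using \<open>X < Y\<close> by auto
      show ?thesis
      proof (cases "X = {}")
        case True
        then show ?thesis
          using box[of I' J'] Y \<open>Y \<noteq> {}\<close> by (auto simp: \<rho>_def)
      next
        case False
        have fin: "finite I'" "finite J'"
          using Y assms finite_subset by blast+
        have sub: "I \<subseteq> I'" "J \<subseteq> J'"
          using False X(1) Y(1) \<open>X < Y\<close> by (auto simp: times_subset_iff less_le)
        have le: "card I \<le> card I'" "card J \<le> card J'"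
          using sub fin by (auto intro: card_mono)
        have "I \<noteq> I' \<or> J \<noteq> J'"
          using X Y \<open>X < Y\<close> by auto
        then have "card I < card I' \<or> card J < card J'"
          using sub fin by (meson psubsetI psubset_card_mono)
        then have "card I + card J < card I' + card J'"
          using le by linarith
        then show ?thesis
          using box[of I J] box[of I' J'] X Y False \<open>Y \<noteq> {}\<close> by auto
      qed
    qed
  qed (use assms in \<open>auto intro: finite_box_poset\<close>)
  show "card A + card B - 1 \<le> poset_rank (box_poset A B)"
    using poset_rank_box_poset_ge[OF assms] by simp
qed

lemma sum_nonempty_subsets_card:
  fixes F :: "nat \<Rightarrow> 'c::comm_ring_1"
  assumes "finite A"
  shows "(\<Sum>I\<in>Pow A - {{}}. F (card I)) = (\<Sum>i=1..card A. of_nat (card A choose i) * F i)"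
proof -
  have "(\<Sum>I\<in>Pow A - {{}}. F (card I))
     = (\<Sum>i\<in>{1..card A}. \<Sum>I\<in>{I \<in> Pow A - {{}}. card I = i}. F (card I))"
  proof (rule sum.group[symmetric])
    show "card ` (Pow A - {{}}) \<subseteq> {1..card A}"
      using assms by (auto simp: Suc_le_eq card_gt_0_iff intro: card_mono dest: finite_subset)
  qed (use assms in auto)
  also have "\<dots> = (\<Sum>i=1..card A. of_nat (card A choose i) * F i)"
  proof (rule sum.cong[OF refl])
    fix i assume "i \<in> {1..card A}"
    then have "{I \<in> Pow A - {{}}. card I = i} = {I. I \<subseteq> A \<and> card I = i}"
      by auto
    moreover have "card {I. I \<subseteq> A \<and> card I = i} = card A choose i"
      using assms by (rule n_subsets)
    ultimately have "card {I \<in> Pow A - {{}}. card I = i} = card A choose i"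
      by simp
    then show "(\<Sum>I\<in>{I \<in> Pow A - {{}}. card I = i}. F (card I)) = of_nat (card A choose i) * F i"
      by simp
  qed
  finally show ?thesis .
qed

text \<open>The empty face has many representations \<open>I \<times> J\<close> and is counted
  separately; a nonempty box determines its sides as its projections.\<close>

lemma sum_box_poset:
  fixes s :: "('a \<times> 'b) set \<Rightarrow> 'c::comm_ring_1"
  assumes "finite A" "finite B"
  shows "(\<Sum>X\<in>box_poset A B. s X) = s {} + (\<Sum>I\<in>Pow A - {{}}. \<Sum>J\<in>Pow B - {{}}. s (I \<times> J))"
proof -
  have "(\<Sum>X\<in>box_poset A B. s X) = s {} + (\<Sum>X\<in>box_poset A B - {{}}. s X)"
    using assms finite_box_poset empty_in_box_poset by (intro sum.remove) auto
  also have "(\<Sum>X\<in>box_poset A B - {{}}. s X)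
      = (\<Sum>(I, J)\<in>(Pow A - {{}}) \<times> (Pow B - {{}}). s (I \<times> J))"
    by (rule sum.reindex_bij_witness[of _ "\<lambda>(I, J). I \<times> J" "\<lambda>X. (fst ` X, snd ` X)"])
       (auto intro!: box_posetI elim!: box_posetE simp: fst_image_times snd_image_times split: if_splits)
  also have "\<dots> = (\<Sum>I\<in>Pow A - {{}}. \<Sum>J\<in>Pow B - {{}}. s (I \<times> J))"
    by (simp add: sum.cartesian_product)
  finally show ?thesis .
qed

lemma coeff_binom_prod_sum:
  "coeff (binom_prod_sum a b ([:0, 1:] :: int poly)) i = int (a choose i) * int (b choose i)"
proof -
  have "(of_nat m * of_nat n * [:0, 1:] ^ k :: int poly) = monom (int m * int n) k" for m n k
    by (simp add: monom_altdef of_nat_poly mult.commute)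
  then have "coeff (binom_prod_sum a b ([:0, 1:] :: int poly)) i
    = (\<Sum>k\<le>b. if k = i then int (a choose k) * int (b choose k) else 0)"
    by (simp add: binom_prod_sum_def coeff_sum)
  also have "\<dots> = int (a choose i) * int (b choose i)"
    by (auto simp: binomial_eq_0)
  finally show ?thesis .
qed

text \<open>A nonzero term has \<open>k \<le> a\<close> and \<open>k \<le> b\<close>, so its degree
  \<open>a + 1 + b - k\<close> exceeds \<open>max a b\<close> and hence
  \<open>(a + b) div 2\<close>.\<close>

lemma coeff_power_rev_binom_prod_sum:
  assumes "i \<le> (a + b) div 2"
  shows "coeff ([:0, 1:] ^ Suc a * rev_binom_prod_sum a b ([:0, 1:] :: int poly)) i = 0"
proof -
  have m: "([:0, 1:] ^ Suc a * (of_nat m * of_nat n * [:0, 1:] ^ k) :: int poly) = monom (int m * int n) (Suc a + k)" for m n k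
  proof -
    have "([:0, 1:] ^ Suc a * (of_nat m * of_nat n * [:0, 1:] ^ k) :: int poly)
      = of_nat (m * n) * [:0, 1:] ^ (Suc a + k)"
      by (simp only: power_add of_nat_mult mult_ac)
    then show ?thesis
      by (simp add: monom_altdef of_nat_poly)
  qed
  have "coeff ([:0, 1:] ^ Suc a * rev_binom_prod_sum a b ([:0, 1:] :: int poly)) i
     = (\<Sum>k\<le>b. if Suc a + (b - k) = i then int (a choose k) * int (b choose k) else 0)"
    unfolding rev_binom_prod_sum_def sum_distrib_left m by (simp add: coeff_sum)
  also have "\<dots> = 0"
  proof (rule sum.neutral, rule ballI)
    fix k assume "k \<in> {..b}"
    then have "a < k" if "Suc a + (b - k) = i"
      using that assms by simp
    then show "(if Suc a + (b - k) = i then int (a choose k) * int (b choose k) else 0) = 0"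
      by (simp add: binomial_eq_0)
  qed
  finally show ?thesis .
qed

text \<open>Induction on the number of vertices: proper nonempty faces are smaller boxes, and
  \<open>sum_binom_prod_sum\<close> brings the sum over all faces into the form that
  \<open>toric_g_eqI\<close> asks for.\<close>

lemma toric_g_box_poset:
  assumes "finite A" "A \<noteq> {}" "finite B" "B \<noteq> {}"
  shows "toric_g (box_poset A B) = binom_prod_sum (card A - 1) (card B - 1) [:0, 1:]"
  using assms
proof (induction "card A + card B" arbitrary: A B rule: less_induct)
  case less
  note AB = less.prems
  define a b where "a = card A - 1" and "b = card B - 1"
  have card: "card A = Suc a" "card B = Suc b"
    using AB by (simp_all add: a_def b_def card_gt_0_iff)
  have rank: "poset_rank (box_poset A B) = Suc (a + b)"
    using poset_rank_box_poset[OF AB] card by simp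
  let ?x = "[:0, 1:] :: int poly"
  have x1: "?x - 1 = [:-1, 1:]"
    by (simp add: one_pCons)
  define s where "s X = toric_g (principal_ideal (box_poset A B) X) *
      [:-1, 1:] ^ (poset_rank (box_poset A B) - poset_rank (principal_ideal (box_poset A B) X))" for X
  \<comment> \<open>The top summand is replaced by the claimed value, so that the identity covers
    all faces without presupposing \<open>toric_g\<close> at the top; it is split off again
    below.\<close>
  define s' where "s' = s(A \<times> B := binom_prod_sum a b ?x)"
  have ne: "A \<times> B \<noteq> {}"
    using AB by auto
  have "s' {} = (?x - 1) ^ (a + b + 1)"
  proof -
    have "principal_ideal (box_poset A B) {} = {{}}"
      using empty_in_box_poset by auto
    then show ?thesis
      using ne[symmetric] by (simp add: s'_def s_def toric_singleton rank x1 del: Times_empty)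
  qed
  moreover have "s' (I \<times> J) = binom_prod_sum (card I - 1) (card J - 1) ?x * (?x - 1) ^ (Suc a - card I + (Suc b - card J))"
    if "I \<in> Pow A - {{}}" "J \<in> Pow B - {{}}" for I J
  proof (cases "I \<times> J = A \<times> B")
    case True
    then have "I = A" "J = B"
      using that by (auto simp: times_eq_iff)
    then show ?thesis
      using card by (simp add: s'_def)
  next
    case False
    have fin: "finite I" "finite J" "I \<noteq> {}" "J \<noteq> {}"
      using that AB finite_subset by auto
    have le: "card I \<le> card A" "card J \<le> card B"
      using that AB by (auto intro: card_mono)
    have pos: "0 < card I" "0 < card J"
      using fin by (auto simp: card_gt_0_iff)
    have "card I < card A \<or> card J < card B"
      using that AB False by (metis DiffD1 PowD psubsetI psubset_card_mono)
    then have lt: "card I + card J < card A + card B"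
      using le by linarith
    have "principal_ideal (box_poset A B) (I \<times> J) = box_poset I J"
      using that by (intro principal_ideal_box_poset) auto
    then have "s' (I \<times> J) = binom_prod_sum (card I - 1) (card J - 1) ?x * [:-1, 1:] ^ (Suc (a + b) - (card I + card J - 1))"
      using False less.hyps[OF lt] fin rank by (simp add: s'_def s_def poset_rank_box_poset)
    also have "Suc (a + b) - (card I + card J - 1) = Suc a - card I + (Suc b - card J)"
      using le pos card by simp
    finally show ?thesis
      by (simp only: x1)
  qed
  ultimately have "(\<Sum>X\<in>box_poset A B. s' X) = (?x - 1) ^ (a + b + 1) +
     (\<Sum>I\<in>Pow A - {{}}. \<Sum>J\<in>Pow B - {{}}. binom_prod_sum (card I - 1) (card J - 1) ?x * (?x - 1) ^ (Suc a - card I + (Suc b - card J)))"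
    unfolding sum_box_poset[OF AB(1,3)] by simp
  also have "\<dots> = (?x - 1) ^ (a + b + 1) +
     (\<Sum>i=1..Suc a. of_nat (Suc a choose i) * (\<Sum>j=1..Suc b. of_nat (Suc b choose j) *
        (binom_prod_sum (i - 1) (j - 1) ?x * (?x - 1) ^ (Suc a - i + (Suc b - j)))))"
    by (simp only: sum_nonempty_subsets_card[OF AB(3), of "\<lambda>j. binom_prod_sum (_ - 1) (j - 1) ?x * (?x - 1) ^ (Suc a - _ + (Suc b - j))"]
      sum_nonempty_subsets_card[OF AB(1), of "\<lambda>i. \<Sum>j=1..Suc b. of_nat (Suc b choose j) *
        (binom_prod_sum (i - 1) (j - 1) ?x * (?x - 1) ^ (Suc a - i + (Suc b - j)))"] card)
  also have "\<dots> = ?x ^ Suc a * rev_binom_prod_sum a b ?x"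
    using sum_binom_prod_sum[of a b ?x] by (simp only: sum_distrib_left mult.assoc)
  finally have total: "(\<Sum>X\<in>box_poset A B. s' X) = ?x ^ Suc a * rev_binom_prod_sum a b ?x" .
  have "(\<Sum>X\<in>box_poset A B. s' X) = s' (A \<times> B) + (\<Sum>X\<in>box_poset A B - {A \<times> B}. s' X)"
    using AB finite_box_poset box_poset_top(1) by (intro sum.remove) auto
  also have "(\<Sum>X\<in>box_poset A B - {A \<times> B}. s' X) = (\<Sum>X\<in>box_poset A B - {A \<times> B}. s X)"
    by (rule sum.cong) (auto simp: s'_def)
  finally have sum: "(\<Sum>X\<in>box_poset A B - {A \<times> B}. s X) + binom_prod_sum a b ?x
      = ?x ^ Suc a * rev_binom_prod_sum a b ?x"
    using total by (simp add: s'_def)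
  have "toric_g (box_poset A B) = binom_prod_sum a b ?x"
  proof (rule toric_g_eqI[where t = "A \<times> B", OF _ _ _ _ sum[unfolded s_def]])
    show "coeff (binom_prod_sum a b ?x) i = 0" if "i > (poset_rank (box_poset A B) - 1) div 2" for i
    proof -
      \<comment> \<open>The claimed polynomial has degree at most \<open>min a b\<close>, which is
        at most \<open>(a + b) div 2\<close>.\<close>
      have "a < i \<or> b < i"
        using that rank by linarith
      then show ?thesis
        by (auto simp: coeff_binom_prod_sum binomial_eq_0)
    qed
    show "coeff (?x ^ Suc a * rev_binom_prod_sum a b ?x) i = 0" if "i \<le> (poset_rank (box_poset A B) - 1) div 2" for i
      using that rank by (intro coeff_power_rev_binom_prod_sum) simp
  qed (use AB rank in \<open>auto intro: finite_box_poset box_poset_top(1) dest: bspec[OF box_poset_top(2)]\<close>)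
  then show ?case
    by (simp add: a_def b_def)
qed

section \<open>The hook polytope\<close>

lemma count_list_take_North:
  "k \<le> length s \<Longrightarrow> count_list (take k s) North = card (north_positions s \<inter> {1..k})"
proof (induction k)
  case (Suc k)
  have "north_positions s \<inter> {1..Suc k}
      = (if s ! k = North then insert (Suc k) (north_positions s \<inter> {1..k}) else north_positions s \<inter> {1..k})"
    using Suc.prems by (auto simp: north_positions_def le_Suc_eq)
  then show ?case
    using Suc by (simp add: take_Suc_conv_app_nth)
qed simp

lemma count_list_North: "count_list s North = card (north_positions s)"
proof -
  have "north_positions s \<inter> {1..length s} = north_positions s"
    by (auto simp: north_positions_def)
  then show ?thesis
    using count_list_take_North[of "length s" s] by simp
qed

lemma count_list_North_East: "count_list s North + count_list s East = length s"
proof (induction s)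
  case (Cons x s)
  then show ?case by (cases x) auto
qed simp

lemma count_list_replicate: "count_list (replicate n x) y = (if x = y then n else 0)"
  by (induction n) auto

lemma count_take_hook_lower: "k \<le> a + b \<Longrightarrow> count_list (take k (hook_lower a b)) North = k - a"
  by (simp add: hook_lower_def count_list_replicate)

text \<open>The upper path has one north step among its first \<open>a\<close> steps and then only
  north steps up to its final east step, which the cap \<open>b\<close> accounts for.\<close>

lemma count_take_hook_upper:
  assumes "1 \<le> a" "1 \<le> b" "k \<le> a + b"
  shows "count_list (take k (hook_upper a b)) North = (if k = 0 then 0 else min b (1 + (k - a)))"
  using assms by (cases k) (auto simp: hook_upper_def count_list_replicate take_Cons' min_def)

text \<open>The bases of the lattice path matroid of the hook: that of the lower path, and those
  that trade its north step \<open>a + j\<close> for the east position \<open>i\<close>.\<close>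

definition hook_bases :: "nat \<Rightarrow> nat \<Rightarrow> nat set set" where
  "hook_bases a b = insert {a+1..a+b} ((\<lambda>(i, j). insert i ({a+1..a+b} - {a+j})) ` ({1..a} \<times> {1..b}))"

lemma hook_basesE:
  assumes "B \<in> hook_bases a b"
  obtains "B = {a+1..a+b}"
  | i j where "i \<in> {1..a}" "j \<in> {1..b}" "B = insert i ({a+1..a+b} - {a+j})"
  using assms unfolding hook_bases_def by blast

text \<open>Comparison with the upper path at \<open>k = a\<close> allows at most one north step
  among the first \<open>a\<close> steps. As there are \<open>b\<close> north steps in all, equally
  many positions above \<open>a\<close> are missing.\<close>

lemma north_positions_hook_path:
  assumes "1 \<le> a" "1 \<le> b" "s \<in> hook_paths a b"
  shows "north_positions s \<in> hook_bases a b"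
proof -
  let ?B = "north_positions s" and ?top = "{a+1..a+b}"
  have cnt: "count_list s East = a" "count_list s North = b"
    and below: "weakly_below s (hook_upper a b)"
    using assms(3) by (auto simp: hook_paths_def lattice_paths_def)
  have len: "length s = a + b"
    using cnt count_list_North_East[of s] by simp
  have sub: "?B \<subseteq> {1..a+b}"
    using len by (auto simp: north_positions_def)
  then have fin: "finite ?B"
    using finite_subset by blast
  have card: "card ?B = b"
    using cnt count_list_North by simp
  have "count_list (take a s) North \<le> count_list (take a (hook_upper a b)) North"
    using below len by (auto simp: weakly_below_def)
  then have le: "card (?B \<inter> {1..a}) \<le> 1"
    using assms len count_list_take_North[of a s] count_take_hook_upper[of a b a] by simp
  have un: "?B = (?B \<inter> {1..a}) \<union> (?B \<inter> ?top)"
    using sub by auto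
  have "card ?B = card (?B \<inter> {1..a}) + card (?B \<inter> ?top)"
    by (subst un, rule card_Un_disjoint) (use fin in auto)
  then have card_top: "card (?B \<inter> ?top) = b - card (?B \<inter> {1..a})"
    using card by simp
  have card_diff: "card (?top - ?B) = card (?B \<inter> {1..a})"
  proof -
    have "card (?top - ?B) = card ?top - card (?B \<inter> ?top)"
      by (simp add: card_Diff_subset_Int Int_commute)
    then show ?thesis
      using card_top le assms by simp
  qed
  show ?thesis
  proof (cases "card (?B \<inter> {1..a}) = 0")
    case True
    then have "?B \<inter> {1..a} = {}" "?top - ?B = {}"
      using card_diff by auto
    then have "?B = ?top"
      using un by auto
    then show ?thesis
      by (simp add: hook_bases_def)
  next
    case False
    then have "card (?B \<inter> {1..a}) = 1"
      using le by linarith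
    then obtain i m where i: "?B \<inter> {1..a} = {i}" and m: "?top - ?B = {m}"
      using card_diff by (metis card_1_singletonE)
    have "?B \<inter> ?top = ?top - {m}"
      using m by auto
    then have B: "?B = insert i (?top - {m})"
      using un i by auto
    have "i \<in> {1..a}" "m \<in> ?top"
      using i m by auto
    then have "m - a \<in> {1..b}" "m = a + (m - a)"
      by auto
    then show ?thesis
      using B \<open>i \<in> {1..a}\<close> unfolding hook_bases_def
      by (intro insertI2 image_eqI[of _ _ "(i, m - a)"]) auto
  qed
qed

lemma hook_bases_subset: "B \<in> hook_bases a b \<Longrightarrow> B \<subseteq> {1..a+b}"
  by (auto simp: hook_bases_def)

text \<open>The bounds are the north counts of the lower and the upper path, so each such set comes
  from an admissible path.\<close>

lemma card_hook_bases_Int: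
  assumes "1 \<le> a" "1 \<le> b" "B \<in> hook_bases a b" "k \<le> a + b"
  shows "k - a \<le> card (B \<inter> {1..k})"
    and "card (B \<inter> {1..k}) \<le> (if k = 0 then 0 else min b (1 + (k - a)))"
    and "card B = b"
proof -
  have top: "{a+1..a+b} \<inter> {1..k} = {a+1..k}"
    using assms(4) by auto
  have card_top: "card ({a+1..a+b} \<inter> {1..k}) = k - a"
    unfolding top by simp
  have cB: "card B = b"
  proof (cases "B = {a+1..a+b}")
    case False
    then obtain i j where ij: "B = insert i ({a+1..a+b} - {a+j})" "i \<in> {1..a}" "j \<in> {1..b}"
      using assms(3) by (metis hook_basesE)
    have "card ({a+1..a+b} - {a+j}) = b - 1"
      using ij(3) by (subst card_Diff_singleton) auto
    moreover have "i \<notin> {a+1..a+b} - {a+j}"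
      using ij(2) by auto
    ultimately show ?thesis
      using ij(1) assms(2) by simp
  qed simp
  then show "card B = b" .
  have fin: "finite B"
    using hook_bases_subset[OF assms(3)] finite_subset by blast
  have leb: "card (B \<inter> {1..k}) \<le> b"
    using cB card_mono[OF fin, of "B \<inter> {1..k}"] by simp
  have "k - a \<le> card (B \<inter> {1..k}) \<and> card (B \<inter> {1..k}) \<le> 1 + (k - a)"
  proof (cases "B = {a+1..a+b}")
    case True
    then show ?thesis using card_top by simp
  next
    case False
    then obtain i j where ij: "B = insert i ({a+1..a+b} - {a+j})" "i \<in> {1..a}" "j \<in> {1..b}"
      using assms(3) by (metis hook_basesE)
    have "card (B \<inter> {1..k}) \<le> card (insert i {a+1..k})"
      using ij by (intro card_mono) auto
    also have "\<dots> \<le> 1 + (k - a)"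
      by (simp add: card_insert_if)
    finally have up: "card (B \<inter> {1..k}) \<le> 1 + (k - a)" .
    \<comment> \<open>For \<open>k > a\<close> the element \<open>i\<close> lies in
      \<open>{1..k}\<close> and makes up for the possible loss of \<open>a + j\<close>.\<close>
    have "k - a \<le> card (B \<inter> {1..k})"
    proof (cases "k \<le> a")
      case False
      have "i \<notin> {a+1..k} - {a+j}"
        using ij(2) by auto
      then have "card (insert i ({a+1..k} - {a+j})) = Suc (card ({a+1..k} - {a+j}))"
        by simp
      moreover have "card {a+1..k} \<le> Suc (card ({a+1..k} - {a+j}))"
        using False by (auto simp: card_Diff_singleton_if)
      moreover have "card (insert i ({a+1..k} - {a+j})) \<le> card (B \<inter> {1..k})"
        using fin ij False assms(4) by (intro card_mono) auto
      ultimately show ?thesis by simp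
    qed simp
    then show ?thesis using up by simp
  qed
  then show "k - a \<le> card (B \<inter> {1..k})"
    and "card (B \<inter> {1..k}) \<le> (if k = 0 then 0 else min b (1 + (k - a)))"
    using leb by auto
qed

lemma north_positions_hook_paths:
  assumes "1 \<le> a" "1 \<le> b"
  shows "north_positions ` hook_paths a b = hook_bases a b"
proof
  show "north_positions ` hook_paths a b \<subseteq> hook_bases a b"
    using north_positions_hook_path[OF assms] by auto
  show "hook_bases a b \<subseteq> north_positions ` hook_paths a b"
  proof
    fix B assume B: "B \<in> hook_bases a b"
    \<comment> \<open>Positions are numbered from 1 but list entries from 0, hence
      \<open>Suc l\<close>.\<close>
    define s where "s = map (\<lambda>l. if Suc l \<in> B then North else East) [0..<a+b]"
    have len: "length s = a + b"
      by (simp add: s_def)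
    have pos: "north_positions s = B"
    proof -
      have "s ! (l - 1) = North \<longleftrightarrow> l \<in> B" if "1 \<le> l" "l \<le> a + b" for l
        using that by (simp add: s_def del: upt_Suc)
      then show ?thesis
        using hook_bases_subset[OF B] len by (auto simp: north_positions_def)
    qed
    have north: "count_list s North = b"
      using card_hook_bases_Int(3)[OF assms B, of 0] by (simp add: count_list_North pos)
    moreover have "count_list s East = a"
      using north len count_list_North_East[of s] by simp
    moreover have cnt: "count_list (take k s) North = card (B \<inter> {1..k})" if "k \<le> a + b" for k
      using count_list_take_North[of k s] that len pos by simp
    moreover have "weakly_below s (hook_upper a b)"
      unfolding weakly_below_def len
      using card_hook_bases_Int(2)[OF assms B] cnt count_take_hook_upper[OF assms] by presburger
    moreover have "weakly_below (hook_lower a b) s"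
      unfolding weakly_below_def
      using card_hook_bases_Int(1)[OF assms B] cnt count_take_hook_lower[of _ a b]
      by (simp add: hook_lower_def)
    ultimately have "s \<in> hook_paths a b"
      by (simp add: hook_paths_def lattice_paths_def)
    then show "B \<in> north_positions ` hook_paths a b"
      using pos by blast
  qed
qed

section \<open>The points spanning the hook polytope and the faces they determine\<close>

definition indicator_vec :: "(nat \<Rightarrow> 'n::finite) \<Rightarrow> nat set \<Rightarrow> real ^ 'n" where
  "indicator_vec idx B = (\<Sum>i\<in>B. axis (idx i) 1)"

definition hook_apex :: "(nat \<Rightarrow> 'n::finite) \<Rightarrow> nat \<Rightarrow> nat \<Rightarrow> real ^ 'n" where
  "hook_apex idx a b = indicator_vec idx {a+1..a+b}"

definition hook_vertex :: "(nat \<Rightarrow> 'n::finite) \<Rightarrow> nat \<Rightarrow> nat \<Rightarrow> nat \<Rightarrow> nat \<Rightarrow> real ^ 'n" where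
  "hook_vertex idx a b i j = hook_apex idx a b + axis (idx i) 1 - axis (idx (a + j)) 1"

definition hook_vertices :: "(nat \<Rightarrow> 'n::finite) \<Rightarrow> nat \<Rightarrow> nat \<Rightarrow> (real ^ 'n) set" where
  "hook_vertices idx a b =
     insert (hook_apex idx a b) ((\<lambda>(i, j). hook_vertex idx a b i j) ` ({1..a} \<times> {1..b}))"

lemma indicator_vec_hook_basis:
  assumes "i \<in> {1..a}" "j \<in> {1..b}"
  shows "indicator_vec idx (insert i ({a+1..a+b} - {a+j})) = hook_vertex idx a b i j"
proof -
  have "i \<notin> {a+1..a+b} - {a+j}" "a + j \<in> {a+1..a+b}"
    using assms by auto
  then show ?thesis
    by (simp add: indicator_vec_def hook_vertex_def hook_apex_def sum_diff1)
qed

lemma hook_polytope_eq: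
  assumes "1 \<le> a" "1 \<le> b"
  shows "hook_polytope idx a b = convex hull (hook_vertices idx a b)"
proof -
  have "(\<lambda>s. \<Sum>i\<in>north_positions s. axis (idx i) 1) ` hook_paths a b
      = indicator_vec idx ` north_positions ` hook_paths a b"
    by (simp add: image_image indicator_vec_def)
  also have "\<dots> = indicator_vec idx ` hook_bases a b"
    by (simp add: north_positions_hook_paths[OF assms])
  also have "\<dots> = hook_vertices idx a b"
  proof -
    have "indicator_vec idx ` (\<lambda>(i, j). insert i ({a+1..a+b} - {a+j})) ` ({1..a} \<times> {1..b})
        = (\<lambda>(i, j). hook_vertex idx a b i j) ` ({1..a} \<times> {1..b})"
      unfolding image_image by (rule image_cong) (auto simp: indicator_vec_hook_basis[simplified])
    then show ?thesis
      unfolding hook_bases_def hook_vertices_def hook_apex_def image_insert by simp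
  qed
  finally show ?thesis
    by (simp add: hook_polytope_def)
qed

lemma finite_hook_vertices: "finite (hook_vertices idx a b)"
  by (simp add: hook_vertices_def)

text \<open>A face is the hull of some of the spanning points, and these lie in
  \<open>V \<inter> F\<close>; convexity gives the other inclusion. So the spanning points in a face
  determine it.\<close>

lemma face_of_convex_hull_eq:
  fixes V :: "'a::euclidean_space set"
  assumes "finite V" "F face_of convex hull V"
  shows "F = convex hull (V \<inter> F)"
proof
  obtain V' where V': "V' \<subseteq> V" "F = convex hull V'"
    using face_of_convex_hull_subset[OF finite_imp_compact[OF assms(1)] assms(2)] by blast
  then have "V' \<subseteq> V \<inter> F"
    using hull_subset by fastforce
  then show "F \<subseteq> convex hull (V \<inter> F)"
    using V'(2) hull_mono by metis
  show "convex hull (V \<inter> F) \<subseteq> F"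
    using face_of_imp_convex[OF assms(2)] by (simp add: hull_minimal)
qed

text \<open>The common midpoint lies in \<open>F\<close> by convexity. If
  \<open>u \<noteq> v\<close>, it is interior to their segment and the face property yields both
  ends; otherwise it is \<open>u\<close> itself.\<close>

lemma face_of_midpoint_exchange:
  fixes F :: "'a::euclidean_space set"
  assumes "F face_of P" "p \<in> F" "q \<in> F" "u \<in> P" "v \<in> P" "p + q = u + v"
  shows "u \<in> F"
proof -
  have mid: "midpoint u v \<in> F"
  proof -
    have "midpoint p q \<in> F"
      using assms(2,3) face_of_imp_convex[OF assms(1)] by (metis closed_segment_subset midpoint_in_closed_segment subsetD)
    then show ?thesis
      using assms(6) by (simp add: midpoint_def)
  qed
  show ?thesis
  proof (cases "u = v")
    case False
    then have "midpoint u v \<in> open_segment u v"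
      by simp
    then show ?thesis
      using face_ofD[OF assms(1) _ assms(4,5) mid] by blast
  qed (use mid in simp)
qed

text \<open>A face is encoded by the spanning points it contains, in the shape of the pyramid poset,
  the flag standing for the apex.\<close>

definition hook_face_labels ::
  "(nat \<Rightarrow> 'n::finite) \<Rightarrow> nat \<Rightarrow> nat \<Rightarrow> (real ^ 'n) set \<Rightarrow> (nat \<times> nat) set \<times> bool" where
  "hook_face_labels idx a b F =
     ({(i, j). i \<in> {1..a} \<and> j \<in> {1..b} \<and> hook_vertex idx a b i j \<in> F}, hook_apex idx a b \<in> F)"

text \<open>Faces are hulls of the spanning points in them, so inclusion can be tested on these
  points. Injectivity of the labelling will follow by antisymmetry.\<close>

lemma hook_face_labels_le_iff:
  assumes "F face_of convex hull (hook_vertices idx a b)" "G face_of convex hull (hook_vertices idx a b)"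
  shows "hook_face_labels idx a b F \<le> hook_face_labels idx a b G \<longleftrightarrow> F \<subseteq> G"
proof
  assume le: "hook_face_labels idx a b F \<le> hook_face_labels idx a b G"
  have "hook_vertices idx a b \<inter> F \<subseteq> hook_vertices idx a b \<inter> G"
    using le by (auto simp: hook_face_labels_def hook_vertices_def less_eq_prod_def subset_eq)
  then show "F \<subseteq> G"
    using face_of_convex_hull_eq[OF finite_hook_vertices assms(1)]
      face_of_convex_hull_eq[OF finite_hook_vertices assms(2)] hull_mono by metis
next
  assume "F \<subseteq> G"
  then show "hook_face_labels idx a b F \<le> hook_face_labels idx a b G"
    by (auto simp: hook_face_labels_def less_eq_prod_def)
qed

text \<open>By the parallelogram relation, a face containing the vertices \<open>(i, j)\<close> and \<open>(i', j')\<close> also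
  contains \<open>(i, j')\<close>.\<close>

lemma hook_face_labels_in_pyramid:
  assumes "F face_of convex hull (hook_vertices idx a b)"
  shows "hook_face_labels idx a b F \<in> box_poset {1..a} {1..b} \<times> UNIV"
proof -
  define S where "S = {(i, j). i \<in> {1..a} \<and> j \<in> {1..b} \<and> hook_vertex idx a b i j \<in> F}"
  have "(i, j') \<in> S" if "(i, j) \<in> S" "(i', j') \<in> S" for i j i' j'
  proof -
    have ij: "i \<in> {1..a}" "j \<in> {1..b}" "i' \<in> {1..a}" "j' \<in> {1..b}"
      using that by (auto simp: S_def)
    have hull: "hook_vertex idx a b i j' \<in> convex hull (hook_vertices idx a b)"
      "hook_vertex idx a b i' j \<in> convex hull (hook_vertices idx a b)"
      using ij by (auto simp: hook_vertices_def intro!: hull_inc)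
    have F: "hook_vertex idx a b i j \<in> F" "hook_vertex idx a b i' j' \<in> F"
      using that by (auto simp: S_def)
    have sum: "hook_vertex idx a b i j + hook_vertex idx a b i' j'
        = hook_vertex idx a b i j' + hook_vertex idx a b i' j"
      by (simp add: hook_vertex_def)
    have "hook_vertex idx a b i j' \<in> F"
      by (rule face_of_midpoint_exchange[OF assms F hull sum])
    then show ?thesis
      using ij by (auto simp: S_def)
  qed
  then have "S = fst ` S \<times> snd ` S"
    by force
  moreover have "fst ` S \<subseteq> {1..a}" "snd ` S \<subseteq> {1..b}"
    by (auto simp: S_def)
  ultimately have "S \<in> box_poset {1..a} {1..b}"
    unfolding box_poset_def by blast
  then show ?thesis
    by (simp add: hook_face_labels_def S_def)
qed

text \<open>Injectivity of \<open>idx\<close> on \<open>A\<close> lets a linear functional take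
  prescribed values on the numbered unit vectors.\<close>

lemma inner_coordinates:
  fixes idx :: "nat \<Rightarrow> 'n::finite" and w :: "nat \<Rightarrow> real"
  assumes "inj_on idx A"
  obtains c :: "real ^ 'n" where "\<And>l. l \<in> A \<Longrightarrow> c \<bullet> axis (idx l) 1 = w l"
proof
  show "(\<chi> n. w (inv_into A idx n)) \<bullet> axis (idx l) 1 = w l" if "l \<in> A" for l
    using that assms by (simp add: inner_axis)
qed

lemma hook_face_exists:
  fixes idx :: "nat \<Rightarrow> 'n::finite"
  assumes inj: "inj_on idx {1..a+b}" and IJ: "I \<subseteq> {1..a}" "J \<subseteq> {1..b}"
  obtains F where "F face_of convex hull (hook_vertices idx a b)" "hook_face_labels idx a b F = (I \<times> J, e)"
proof -
  \<comment> \<open>Each index outside \<open>I\<close> or \<open>J\<close> costs 1; the sign for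
    \<open>J\<close> is negative because \<open>hook_vertex\<close> subtracts that unit vector. If
    the apex is to be excluded, \<open>of_bool (\<not> e)\<close> lowers all other spanning points
    by 1 relative to it.\<close>
  define w :: "nat \<Rightarrow> real" where
    "w l = (if l \<le> a then of_bool (l \<notin> I) - of_bool (\<not> e) else - of_bool (l - a \<notin> J))" for l
  obtain c :: "real ^ 'n" where c: "\<And>l. l \<in> {1..a+b} \<Longrightarrow> c \<bullet> axis (idx l) 1 = w l"
    using inner_coordinates[OF inj] by blast
  \<comment> \<open>\<open>d\<close> bounds the functional from below but need not be attained: with
    \<open>I\<close> or \<open>J\<close> empty and \<open>e\<close> false, the hyperplane misses the
    polytope and yields the empty face.\<close>
  define d where "d = c \<bullet> hook_apex idx a b - of_bool (\<not> e)"
  have apex: "c \<bullet> hook_apex idx a b = d + of_bool (\<not> e)"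
    by (simp add: d_def)
  have vertex: "c \<bullet> hook_vertex idx a b i j = d + of_bool (i \<notin> I) + of_bool (j \<notin> J)"
    if "i \<in> {1..a}" "j \<in> {1..b}" for i j
    using that c[of i] c[of "a + j"]
    by (simp add: hook_vertex_def inner_add_right inner_diff_right apex w_def)
  have "hook_vertices idx a b \<subseteq> {x. c \<bullet> x \<ge> d}"
    by (auto simp: hook_vertices_def apex vertex)
  then have "convex hull (hook_vertices idx a b) \<subseteq> {x. c \<bullet> x \<ge> d}"
    by (simp add: hull_minimal convex_halfspace_ge)
  then have face: "(convex hull (hook_vertices idx a b) \<inter> {x. c \<bullet> x = d}) face_of convex hull (hook_vertices idx a b)"
    by (intro face_of_Int_supporting_hyperplane_ge) auto
  have mem: "v \<in> convex hull (hook_vertices idx a b)" if "v \<in> hook_vertices idx a b" for v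
    using that by (rule hull_inc)
  have "hook_vertex idx a b i j \<in> convex hull (hook_vertices idx a b) \<inter> {x. c \<bullet> x = d} \<longleftrightarrow> i \<in> I \<and> j \<in> J"
    if "i \<in> {1..a}" "j \<in> {1..b}" for i j
  proof -
    have "hook_vertex idx a b i j \<in> hook_vertices idx a b"
      using that by (auto simp: hook_vertices_def)
    then show ?thesis
      using mem vertex[OF that] by (auto simp: of_bool_def split: if_splits)
  qed
  moreover have "hook_apex idx a b \<in> convex hull (hook_vertices idx a b) \<inter> {x. c \<bullet> x = d} \<longleftrightarrow> e"
    using mem[of "hook_apex idx a b"] apex by (auto simp: hook_vertices_def)
  ultimately have "hook_face_labels idx a b (convex hull (hook_vertices idx a b) \<inter> {x. c \<bullet> x = d}) = (I \<times> J, e)"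
    using IJ unfolding hook_face_labels_def by blast
  then show ?thesis
    using that face by blast
qed

lemma bij_betw_hook_face_labels:
  fixes idx :: "nat \<Rightarrow> 'n::finite"
  assumes "1 \<le> a" "1 \<le> b" "inj_on idx {1..a+b}"
  shows "bij_betw (hook_face_labels idx a b) (face_lattice (hook_polytope idx a b))
    (box_poset {1..a} {1..b} \<times> UNIV)"
  unfolding bij_betw_def hook_polytope_eq[OF assms(1,2)] face_lattice_def
proof
  let ?P = "convex hull (hook_vertices idx a b)"
  show "inj_on (hook_face_labels idx a b) {F. F face_of ?P}"
    by (rule inj_onI) (use hook_face_labels_le_iff in \<open>metis mem_Collect_eq order_refl subset_antisym\<close>)
  show "hook_face_labels idx a b ` {F. F face_of ?P} = box_poset {1..a} {1..b} \<times> UNIV"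
  proof
    show "hook_face_labels idx a b ` {F. F face_of ?P} \<subseteq> box_poset {1..a} {1..b} \<times> UNIV"
      using hook_face_labels_in_pyramid by blast
    show "box_poset {1..a} {1..b} \<times> UNIV \<subseteq> hook_face_labels idx a b ` {F. F face_of ?P}"
    proof
      fix z :: "(nat \<times> nat) set \<times> bool"
      assume "z \<in> box_poset {1..a} {1..b} \<times> UNIV"
      then obtain I J e where "z = (I \<times> J, e)" "I \<subseteq> {1..a}" "J \<subseteq> {1..b}"
        by (auto simp: box_poset_def)
      then show "z \<in> hook_face_labels idx a b ` {F. F face_of ?P}"
        using hook_face_exists[OF assms(3), of I J e] by (metis imageI mem_Collect_eq)
    qed
  qed
qed

theorem theorem5:
  fixes \<alpha> \<beta> :: nat and idx :: "nat \<Rightarrow> 'n::finite"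
  assumes "1 \<le> \<beta>" and "\<beta> \<le> \<alpha>"
    and "bij_betw idx {1..\<alpha> + \<beta>} (UNIV :: 'n set)"
  shows "toric_g (face_lattice (hook_polytope idx \<alpha> \<beta>)) =
    (\<Sum>k = 0..\<beta> - 1. monom (int ((\<alpha> - 1) choose k) * int ((\<beta> - 1) choose k)) k)"
proof -
  let ?L = "box_poset {1..\<alpha>} {1..\<beta>}"
  have ab: "1 \<le> \<alpha>" "1 \<le> \<beta>"
    using assms by auto
  have "toric_g (face_lattice (hook_polytope idx \<alpha> \<beta>)) = toric_g (?L \<times> (UNIV :: bool set))"
  proof (rule conjunct2[OF toric_iso])
    show "bij_betw (hook_face_labels idx \<alpha> \<beta>) (face_lattice (hook_polytope idx \<alpha> \<beta>)) (?L \<times> UNIV)"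
      by (rule bij_betw_hook_face_labels[OF ab bij_betw_imp_inj_on[OF assms(3)]])
  next
    fix F G assume "F \<in> face_lattice (hook_polytope idx \<alpha> \<beta>)" "G \<in> face_lattice (hook_polytope idx \<alpha> \<beta>)"
    then show "hook_face_labels idx \<alpha> \<beta> F \<le> hook_face_labels idx \<alpha> \<beta> G \<longleftrightarrow> F \<le> G"
      by (simp add: face_lattice_def hook_polytope_eq[OF ab] hook_face_labels_le_iff)
  qed
  also have "\<dots> = toric_g ?L"
    by (rule toric_g_pyramid[OF finite_box_poset box_poset_top]) simp_all
  also have "\<dots> = binom_prod_sum (\<alpha> - 1) (\<beta> - 1) [:0, 1:]"
    using toric_g_box_poset[of "{1..\<alpha>}" "{1..\<beta>}"] ab by simp
  \<comment> \<open>Coefficients are compared; above degree \<open>\<beta> - 1\<close> the second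
    binomial coefficient vanishes.\<close>
  also have "\<dots> = (\<Sum>k = 0..\<beta> - 1. monom (int ((\<alpha> - 1) choose k) * int ((\<beta> - 1) choose k)) k)"
    by (rule poly_eqI) (auto simp: coeff_binom_prod_sum coeff_sum binomial_eq_0)
  finally show ?thesis .
qed

end
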